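(* Let $(X, \mathcal B, \mu)$ be a (non-atomic) Lebesgue probability space, let $\mathbb P$ be a finite measurable partition of $X$, let $T : X \to X$ be an ergodic invertible measure-preserving transformation, and let $N \in \mathbb N$ (so $N \ge 1$). Then there exist measurable sets $B, E \subset X$ such that the sets $B, TB, \dots, T^{N-1}B, E$ form a partition of $X$ (modulo null sets), $T(E) \subset B$ (modulo null sets), and $B$ is independent of $\mathbb P$, i.e. $\mu(B \cap P) = \mu(B)\,\mu(P)$ for every cell $P \in \mathbb P$.
   Context: All sets are measurable, and null sets are disregarded: "partition" means a family of measurable sets that are pairwise disjoint and cover $X$ up to null sets (the error set $E$ is allowed to be null). A Lebesgue probability space here means a standard non-atomic probability space, i.e. one isomorphic mod null sets to $[0,1]$ with Lebesgue measure. Such a family $\{B, TB, \dots, T^{N-1}B, E\}$ is called a Rohlin tower of height $N$ with base $B$ and error set $E$; when in addition $T(E)\subset B$ it is called an Alpern tower. *)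

theory Defs
  imports "HOL-Probability.Probability"
begin

definition iso_mod_null :: "'a measure \<Rightarrow> 'b measure \<Rightarrow> bool" where
  "iso_mod_null M N \<longleftrightarrow>
    (\<exists>X0\<in>sets M. \<exists>Y0\<in>sets N. \<exists>f.
       space M - X0 \<in> null_sets M \<and> space N - Y0 \<in> null_sets N \<and>
       bij_betw f X0 Y0 \<and>
       f \<in> measurable (restrict_space M X0) (restrict_space N Y0) \<and>
       the_inv_into X0 f \<in> measurable (restrict_space N Y0) (restrict_space M X0) \<and>
       distr (restrict_space M X0) (restrict_space N Y0) f = restrict_space N Y0)"

(* Passing to the completion admits both usual conventions: M may be a complete (Rokhlin) space
   or carry only a standard Borel sigma-algebra. If M is complete, completion M = M. *)
definition lebesgue_prob_space :: "'a measure \<Rightarrow> bool" where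
  "lebesgue_prob_space M \<longleftrightarrow>
    prob_space M \<and> iso_mod_null (completion M) (lebesgue_on {0..1::real})"

(* Pairwise disjointness and covering are both understood up to null sets. The family is indexed,
   so null cells and repeated null cells are allowed. *)
definition partition_mod_null :: "'a measure \<Rightarrow> 'i set \<Rightarrow> ('i \<Rightarrow> 'a set) \<Rightarrow> bool" where
  "partition_mod_null M I F \<longleftrightarrow>
    (\<forall>i\<in>I. F i \<in> sets M) \<and>
    (\<forall>i\<in>I. \<forall>j\<in>I. i \<noteq> j \<longrightarrow> F i \<inter> F j \<in> null_sets M) \<and>
    space M - (\<Union>i\<in>I. F i) \<in> null_sets M"

(* Invertibility is understood up to null sets; a bijection of space M with measurable inverse
   is the special case in which both identities hold everywhere. *)
definition invertible_mpt :: "'a measure \<Rightarrow> ('a \<Rightarrow> 'a) \<Rightarrow> bool" where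
  "invertible_mpt M T \<longleftrightarrow>
    T \<in> measurable M M \<and> distr M M T = M \<and>
    (\<exists>S \<in> measurable M M. (AE x in M. S (T x) = x) \<and> (AE x in M. T (S x) = x))"

definition ergodic :: "'a measure \<Rightarrow> ('a \<Rightarrow> 'a) \<Rightarrow> bool" where
  "ergodic M T \<longleftrightarrow>
    (\<forall>A\<in>sets M. T -` A \<inter> space M = A \<longrightarrow> A \<in> null_sets M \<or> space M - A \<in> null_sets M)"

(* The indices i < N carry the levels of the tower, the index N carries the error set. *)
definition rohlin_tower :: "'a measure \<Rightarrow> ('a \<Rightarrow> 'a) \<Rightarrow> nat \<Rightarrow> 'a set \<Rightarrow> 'a set \<Rightarrow> bool" where
  "rohlin_tower M T N B E \<longleftrightarrow>
    partition_mod_null M {..N} (\<lambda>i. if i < N then (T ^^ i) ` B else E)"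

definition alpern_tower :: "'a measure \<Rightarrow> ('a \<Rightarrow> 'a) \<Rightarrow> nat \<Rightarrow> 'a set \<Rightarrow> 'a set \<Rightarrow> bool" where
  "alpern_tower M T N B E \<longleftrightarrow> rohlin_tower M T N B E \<and> T ` E - B \<in> null_sets M"

end

theory Submission
  imports Defs
begin

text \<open>
  Writing \<open>f\<close> for a function of the cell of \<open>\<P>\<close> with mean zero, the bases of height-\<open>N\<close> Alpern towers
  that contain a fixed set \<open>A\<close> with bounded return times form a convex family: two of them are mixed by
  using one or the other on different columns over \<open>A\<close>, the columns being chosen independently of
  everything relevant because the space is non-atomic. By a finite-dimensional separation argument, a
  base independent of \<open>\<P>\<close> exists as soon as every such \<open>f \<noteq> 0\<close> has negative integral over some base.
  To find that base, tile long columns periodically, with an arbitrary phase, by blocks of length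
  \<open>2N + 1\<close>, each of which can be split as \<open>N, N + 1\<close> or as \<open>N + 1, N\<close>. Choosing the split that gives
  the smaller value of \<open>f\<close> gains, on average over the phase, a fixed multiple of
  \<open>\<integral> \<bar>f - f \<circ> T\<bar>\<close>. By ergodicity this bounds \<open>f\<close> uniformly, so for long columns the gain exceeds the
  loss near the ends of the columns.
\<close>

text \<open>The set \<open>A\<close>, and with it the column heights, has to be fixed before the
  separating functional is known. A gain that depends on \<open>f\<close> is therefore useful only
  if the loss is bounded by the same quantity with a constant depending on the partition and
  \<open>T\<close> alone; both sides are homogeneous in \<open>f\<close>, so one sufficiently large
  \<open>K\<close> then serves every functional. What makes an Alpern tower accessible to tilings is
  that its base can be described by return times: all of them are \<open>N\<close> or
  \<open>N + 1\<close>, and the error set consists of the top points of the longer columns.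
  Requiring all bases to contain \<open>A\<close> makes every column over \<open>A\<close> a
  separate tiling problem, so that choices on different columns never interact. Bounded heights
  leave only finitely many sets from which the choice of columns must be independent. The length
  \<open>2 * N + 1\<close> is the shortest that admits two orderings of \<open>N\<close> and
  \<open>N + 1\<close>; the two differ in a single point, \<open>T^N x\<close> against
  \<open>T^(N+1) x\<close>, which is why the gain is governed by the difference of \<open>f\<close>
  and \<open>f \<circ> T\<close>.\<close>

text \<open>
  Induction on the index set: a functional that is nonnegative on the slice \<open>v k = 0\<close> becomes nonnegative
  on all of \<open>V\<close> for a suitable coefficient \<open>s\<close> at \<open>k\<close>, so the slice inherits the hypothesis and \<open>V\<close>
  need be neither closed nor bounded.
\<close>

lemma convex_set_contains_zero:
  fixes V :: "('i \<Rightarrow> real) set"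
  assumes "finite I" and "V \<noteq> {}"
    and conv: "\<And>u v t. u \<in> V \<Longrightarrow> v \<in> V \<Longrightarrow> 0 \<le> t \<Longrightarrow> t \<le> 1 \<Longrightarrow> (\<lambda>i. (1 - t) * u i + t * v i) \<in> V"
    and sep: "\<And>a. (\<And>v. v \<in> V \<Longrightarrow> 0 \<le> (\<Sum>i\<in>I. a i * v i)) \<Longrightarrow>
                   (\<And>v. v \<in> V \<Longrightarrow> (\<Sum>i\<in>I. a i * v i) = 0)"
  shows "\<exists>v\<in>V. \<forall>i\<in>I. v i = 0"
  using assms
proof (induction I arbitrary: V rule: finite_induct)
  case empty
  then show ?case by auto
next
  case (insert k I)
  note conv = insert.prems(2) and sep = insert.prems(3)
  have sum_ins: "(\<Sum>i\<in>insert k I. (a(k := s)) i * v i) = s * v k + (\<Sum>i\<in>I. a i * v i)"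
    for a v :: "'i \<Rightarrow> real" and s
  proof -
    have "(\<Sum>i\<in>I. (a(k := s)) i * v i) = (\<Sum>i\<in>I. a i * v i)"
      using insert.hyps by (intro sum.cong) auto
    then show ?thesis using insert.hyps by simp
  qed
  \<comment> \<open>\<open>w\<close> is the point where the segment from \<open>u\<close> to
    \<open>v\<close> crosses the hyperplane on which coordinate \<open>k\<close> vanishes.\<close>
  have mix: "\<exists>w\<in>V. w k = 0 \<and> (\<forall>a. (\<Sum>i\<in>I. a i * w i) =
      (- v k * (\<Sum>i\<in>I. a i * u i) + u k * (\<Sum>i\<in>I. a i * v i)) / (u k - v k))"
    if "u \<in> V" "v \<in> V" "u k > 0" "v k < 0" for u v
  proof -
    define t where "t = u k / (u k - v k)"
    have t: "0 \<le> t" "t \<le> 1" "1 - t = - v k / (u k - v k)"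
      using that by (auto simp: t_def field_simps)
    have "(1 - t) * u k + t * v k = 0"
      unfolding t(3) unfolding t_def using that by (simp add: field_simps)
    moreover have "(\<Sum>i\<in>I. a i * ((1 - t) * u i + t * v i)) =
      (- v k * (\<Sum>i\<in>I. a i * u i) + u k * (\<Sum>i\<in>I. a i * v i)) / (u k - v k)" for a
    proof -
      have "(\<Sum>i\<in>I. a i * ((1 - t) * u i + t * v i)) =
          (1 - t) * (\<Sum>i\<in>I. a i * u i) + t * (\<Sum>i\<in>I. a i * v i)"
        by (simp add: sum_distrib_left sum.distrib[symmetric] algebra_simps)
      then show ?thesis unfolding t(3) unfolding t_def by (simp add: add_divide_distrib diff_divide_distrib)
    qed
    ultimately show ?thesis using conv[OF that(1,2) t(1,2)] by (intro bexI) auto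
  qed
  \<comment> \<open>The hypothesis \<open>sep\<close> applied to a functional supported at
    \<open>k\<close>: coordinate \<open>k\<close> cannot have a constant sign on \<open>V\<close>
    without vanishing there.\<close>
  have sep1: "\<forall>v\<in>V. s * v k = 0" if "\<forall>v\<in>V. s * v k \<ge> 0" for s
  proof
    fix v assume v: "v \<in> V"
    have eq: "(\<Sum>i\<in>insert k I. ((\<lambda>_. 0)(k := s)) i * v i) = s * v k" for v
      using sum_ins[of "\<lambda>_. 0" s] by simp
    from sep[of "(\<lambda>_. 0)(k := s)", unfolded eq, OF _ v] that show "s * v k = 0" by blast
  qed
  define W where "W = {v \<in> V. v k = 0}"
  have "W \<noteq> {}"
  proof (cases "\<forall>v\<in>V. v k = 0")
    case True
    then show ?thesis using insert.prems(1) by (auto simp: W_def)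
  next
    case False
    from sep1[of 1] sep1[of "-1"]
    have "(\<forall>v\<in>V. 0 \<le> v k) \<longrightarrow> (\<forall>v\<in>V. v k = 0)" "(\<forall>v\<in>V. v k \<le> 0) \<longrightarrow> (\<forall>v\<in>V. v k = 0)"
      by simp_all
    with False have "\<exists>v\<in>V. \<not> 0 \<le> v k" "\<exists>u\<in>V. \<not> u k \<le> 0" by blast+
    then obtain u v where "u \<in> V" "v \<in> V" "u k > 0" "v k < 0"
      unfolding not_le by blast
    from mix[OF this] show ?thesis by (auto simp: W_def)
  qed
  moreover have "(\<lambda>i. (1 - t) * u i + t * v i) \<in> W" if "u \<in> W" "v \<in> W" "0 \<le> t" "t \<le> 1" for u v t
    using that conv by (auto simp: W_def)
  moreover have "(\<Sum>i\<in>I. a i * v i) = 0"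
    if nn: "\<And>v. v \<in> W \<Longrightarrow> 0 \<le> (\<Sum>i\<in>I. a i * v i)" and "v \<in> W" for a v
  proof -
    define h where "h v = (\<Sum>i\<in>I. a i * v i)" for v
    \<comment> \<open>Nonnegativity at the crossing point, cleared of denominators, says that every
      lower bound for the sought coefficient \<open>s\<close> is at most every upper bound.\<close>
    have cross: "- h u / u k \<le> h v / (- v k)" if uv: "u \<in> V" "v \<in> V" "u k > 0" "v k < 0" for u v
    proof -
      from mix[OF uv] obtain w where "w \<in> V" "w k = 0" "h w = (- v k * h u + u k * h v) / (u k - v k)"
        unfolding h_def by blast
      with nn[of w] have "0 \<le> (- v k * h u + u k * h v) / (u k - v k)" by (simp add: W_def h_def)
      then have "0 \<le> - v k * h u + u k * h v" using uv by (simp add: zero_le_divide_iff)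
      then show ?thesis using uv by (simp add: field_simps)
    qed
    \<comment> \<open>Any \<open>s\<close> between the lower and the upper bounds will do, for
      instance the supremum of the lower ones. If one of the two signs does not occur,
      \<open>sep1\<close> makes coordinate \<open>k\<close> vanish on all of \<open>V\<close>, and
      \<open>0\<close> serves.\<close>
    obtain s where s: "\<And>u. u \<in> V \<Longrightarrow> u k > 0 \<Longrightarrow> - h u / u k \<le> s"
      "\<And>v. v \<in> V \<Longrightarrow> v k < 0 \<Longrightarrow> s \<le> h v / (- v k)"
    proof (cases "\<exists>u\<in>V. u k > 0")
      case True
      show ?thesis
      proof (cases "\<exists>v\<in>V. v k < 0")
        case T2: True
        let ?A = "{- h u / u k | u. u \<in> V \<and> u k > 0}"
        from T2 obtain v where v: "v \<in> V" "v k < 0" by auto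
        have "bdd_above ?A" using cross[OF _ v(1) _ v(2)] by (intro bdd_aboveI[of _ "h v / (- v k)"]) auto
        then have "- h u / u k \<le> Sup ?A" if "u \<in> V" "u k > 0" for u
          using that by (intro cSup_upper) auto
        moreover have "Sup ?A \<le> h v / (- v k)" if "v \<in> V" "v k < 0" for v
          using True cross[OF _ that(1) _ that(2)] by (intro cSup_least) auto
        ultimately show ?thesis by (rule that)
      next
        case False
        then have "\<forall>v\<in>V. 0 \<le> v k" by (auto simp: not_less)
        then have "\<forall>v\<in>V. 1 * v k = 0" by (intro sep1) simp
        with True show ?thesis by auto
      qed
    next
      case False
      then have "\<forall>v\<in>V. -1 * v k = 0" by (intro sep1) (simp add: not_less)
      then show ?thesis by (intro that[of 0]) auto
    qed
    have "0 \<le> s * v k + h v" if "v \<in> V" for v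
    proof (cases "v k" "0 :: real" rule: linorder_cases)
      case less
      then show ?thesis using s(2)[OF that less] by (simp add: field_simps)
    next
      case equal
      then show ?thesis using nn[of v] that by (simp add: W_def h_def)
    next
      case greater
      then show ?thesis using s(1)[OF that greater] by (simp add: field_simps)
    qed
    then have "s * v k + h v = 0" if "v \<in> V" for v
      using sep[of "a(k := s)" v] that unfolding sum_ins h_def by blast
    then show ?thesis using \<open>v \<in> W\<close> by (force simp: W_def h_def)
  qed
  ultimately obtain v where "v \<in> W" "\<forall>i\<in>I. v i = 0"
    using insert.IH[of W] by blast
  then show ?case by (auto simp: W_def)
qed

section \<open>Membership patterns and sets independent of a finite family\<close>

lemma measurable_funpow:
  assumes "f \<in> measurable M M"
  shows "f ^^ n \<in> measurable M M"
  using assms by (induction n) (auto intro: measurable_comp)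

lemma sets_level_set:
  assumes c: "c \<in> measurable M (count_space I)"
  shows "{x \<in> space M. c x = i} \<in> sets M"
proof -
  have "{x \<in> space M. c x = i} = c -` ({i} \<inter> I) \<inter> space M" using measurable_space[OF c] by auto
  moreover have "c -` ({i} \<inter> I) \<inter> space M \<in> sets M" by (rule measurable_sets[OF c]) simp
  ultimately show ?thesis by simp
qed

lemma sets_membership_pattern:
  assumes "finite \<F>" and "\<F> \<subseteq> sets M"
  shows "{x \<in> space M. \<forall>F\<in>\<F>. x \<in> F \<longleftrightarrow> F \<in> v} \<in> sets M"
proof (intro sets.sets_Collect_finite_All assms(1))
  show "{x \<in> space M. x \<in> F \<longleftrightarrow> F \<in> v} \<in> sets M" if "F \<in> \<F>" for F
    using that assms(2) by (cases "F \<in> v") (auto simp: Int_def[symmetric] set_diff_eq[symmetric])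
qed

text \<open>The intermediate value property of non-atomic measures. It is the form in which
  non-atomicity enters the construction, and it survives restriction to a set of full
  measure.\<close>

definition divisible_measure :: "'a measure \<Rightarrow> bool" where
  "divisible_measure M \<longleftrightarrow> (\<forall>C\<in>sets M. \<forall>r. 0 \<le> r \<and> r \<le> measure M C \<longrightarrow>
      (\<exists>D\<in>sets M. D \<subseteq> C \<and> measure M D = r))"

text \<open>Every member of \<open>\<F>\<close> is a disjoint union of atoms of the finite algebra
  that \<open>\<F>\<close> generates. Taking the proportion \<open>t\<close> of each atom thus gives
  the proportion \<open>t\<close> of each member. The atoms are indexed by membership patterns
  \<open>v\<close>.\<close>

lemma (in prob_space) independent_set_exists:
  assumes div: "divisible_measure M" and fin: "finite \<F>" and sets: "\<F> \<subseteq> sets M" and t: "0 \<le> t" "t \<le> (1::real)"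
  shows "\<exists>D\<in>sets M. \<forall>F\<in>\<F>. prob (D \<inter> F) = t * prob F"
proof -
  define cell where "cell v = {x \<in> space M. \<forall>F\<in>\<F>. x \<in> F \<longleftrightarrow> F \<in> v}" for v
  have cell: "cell v \<in> sets M" for v
    unfolding cell_def by (rule sets_membership_pattern[OF fin sets])
  have "\<forall>v. \<exists>D\<in>sets M. D \<subseteq> cell v \<and> prob D = t * prob (cell v)"
  proof
    fix v
    have "0 \<le> t * prob (cell v)" "t * prob (cell v) \<le> prob (cell v)"
      using t by (auto intro!: mult_left_le_one_le)
    then show "\<exists>D\<in>sets M. D \<subseteq> cell v \<and> prob D = t * prob (cell v)"
      using div cell[of v] unfolding divisible_measure_def by blast
  qed
  then obtain D where D: "\<And>v. D v \<in> sets M" "\<And>v. D v \<subseteq> cell v" "\<And>v. prob (D v) = t * prob (cell v)"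
    by metis
  have disj: "disjoint_family_on cell (Pow \<F>)"
    unfolding disjoint_family_on_def cell_def by blast
  then have disjD: "disjoint_family_on D (Pow \<F>)"
    using D(2) unfolding disjoint_family_on_def by blast
  let ?D = "\<Union>v\<in>Pow \<F>. D v"
  have "prob (?D \<inter> F) = t * prob F" if "F \<in> \<F>" for F
  proof -
    let ?V = "{v\<in>Pow \<F>. F \<in> v}"
    have F: "F = (\<Union>v\<in>?V. cell v)"
    proof
      show "F \<subseteq> (\<Union>v\<in>?V. cell v)"
      proof
        fix x assume x: "x \<in> F"
        then have "x \<in> space M" using that sets sets.sets_into_space by blast
        then have "x \<in> cell {F \<in> \<F>. x \<in> F}" by (auto simp: cell_def)
        moreover have "{F \<in> \<F>. x \<in> F} \<in> ?V" using x that by auto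
        ultimately show "x \<in> (\<Union>v\<in>?V. cell v)" by (rule UN_I[rotated])
      qed
    qed (use that in \<open>auto simp: cell_def\<close>)
    have DF: "?D \<inter> F = (\<Union>v\<in>?V. D v)"
    proof (intro equalityI subsetI)
      fix x assume "x \<in> ?D \<inter> F"
      then obtain v where v: "v \<in> Pow \<F>" "x \<in> D v" "x \<in> F" by auto
      then have "x \<in> cell v" using D(2) by blast
      then have "F \<in> v" using v(3) that by (simp add: cell_def)
      then show "x \<in> (\<Union>v\<in>?V. D v)" using v by auto
    next
      fix x assume "x \<in> (\<Union>v\<in>?V. D v)"
      then obtain v where v: "v \<in> Pow \<F>" "F \<in> v" "x \<in> D v" by auto
      then have "x \<in> cell v" using D(2) by blast
      then have "x \<in> F" using v(2) that by (simp add: cell_def)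
      then show "x \<in> ?D \<inter> F" using v by blast
    qed
    have "prob (?D \<inter> F) = (\<Sum>v\<in>?V. prob (D v))"
      unfolding DF using fin D(1) disjD
      by (intro finite_measure_finite_Union) (auto simp: disjoint_family_on_def)
    also have "\<dots> = t * (\<Sum>v\<in>?V. prob (cell v))"
      by (simp add: D(3) sum_distrib_left)
    also have "(\<Sum>v\<in>?V. prob (cell v)) = prob (\<Union>v\<in>?V. cell v)"
      using fin cell disj
      by (intro finite_measure_finite_Union[symmetric]) (auto simp: disjoint_family_on_def)
    finally show ?thesis using F by simp
  qed
  moreover have "?D \<in> sets M" using fin D(1) by auto
  ultimately show ?thesis by blast
qed

section \<open>Tilings of intervals of natural numbers\<close>

text \<open>\<open>\<tau>\<close> is the set of starting points of the tiles, \<open>\<Lambda> p\<close> the set of lengths allowed for a tile starting at \<open>p\<close>.\<close>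

definition tiled :: "nat set \<Rightarrow> (nat \<Rightarrow> nat set) \<Rightarrow> nat \<Rightarrow> nat \<Rightarrow> bool" where
  "tiled \<tau> \<Lambda> a b \<longleftrightarrow> a \<le> b \<and> (a < b \<longrightarrow> a \<in> \<tau>) \<and> (\<forall>p\<in>\<tau>. a \<le> p \<and> p < b \<and>
     (\<exists>l\<in>\<Lambda> p. (p + l \<in> \<tau> \<or> p + l = b) \<and> (\<forall>q. p < q \<and> q < p + l \<longrightarrow> q \<notin> \<tau>)))"

text \<open>Starting points of \<open>\<sigma>\<close> lie in \<open>[a, b)\<close> and those of
  \<open>\<tau>\<close> in \<open>[b, c)\<close>, so no tile of one is cut by the other. A tile of
  \<open>\<sigma>\<close> ending at \<open>b\<close> is followed by the first tile of
  \<open>\<tau>\<close>, or \<open>b = c\<close>.\<close>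

lemma tiled_Un:
  assumes "tiled \<sigma> \<Lambda> a b" and "tiled \<tau> \<Lambda> b c"
  shows "tiled (\<sigma> \<union> \<tau>) \<Lambda> a c"
  unfolding tiled_def
proof (intro conjI ballI impI)
  show "a \<le> c" using assms by (auto simp: tiled_def)
  show "a \<in> \<sigma> \<union> \<tau>" if "a < c"
    using assms that by (cases "a < b") (auto simp: tiled_def)
  fix p assume p: "p \<in> \<sigma> \<union> \<tau>"
  show "a \<le> p" "p < c" using p assms by (fastforce simp: tiled_def)+
  show "\<exists>l\<in>\<Lambda> p. (p + l \<in> \<sigma> \<union> \<tau> \<or> p + l = c) \<and> (\<forall>q. p < q \<and> q < p + l \<longrightarrow> q \<notin> \<sigma> \<union> \<tau>)"
  proof (cases "p \<in> \<sigma>")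
    case True
    then obtain l where l: "l \<in> \<Lambda> p" "p + l \<in> \<sigma> \<or> p + l = b" "\<forall>q. p < q \<and> q < p + l \<longrightarrow> q \<notin> \<sigma>"
      using assms(1) unfolding tiled_def by blast
    have "p + l \<le> b" using l(2) assms(1) by (auto simp: tiled_def)
    then have "\<forall>q. p < q \<and> q < p + l \<longrightarrow> q \<notin> \<tau>" using assms(2) by (fastforce simp: tiled_def)
    moreover have "p + l \<in> \<sigma> \<union> \<tau> \<or> p + l = c"
      using l(2) assms(2) by (cases "b < c") (auto simp: tiled_def)
    ultimately show ?thesis using l by blast
  next
    case False
    then have "p \<in> \<tau>" using p by simp
    then obtain l where l: "l \<in> \<Lambda> p" "p + l \<in> \<tau> \<or> p + l = c" "\<forall>q. p < q \<and> q < p + l \<longrightarrow> q \<notin> \<tau>"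
      using assms(2) unfolding tiled_def by blast
    have "\<forall>q. p < q \<longrightarrow> q \<notin> \<sigma>" using \<open>p \<in> \<tau>\<close> assms by (fastforce simp: tiled_def)
    then show ?thesis using l by blast
  qed
qed

lemma tiled_progression:
  assumes "0 < l" and "\<And>k. k < m \<Longrightarrow> l \<in> \<Lambda> (a + k * l)"
  shows "tiled ((\<lambda>k. a + k * l) ` {..<m}) \<Lambda> a (a + m * l)"
  unfolding tiled_def
proof (intro conjI ballI impI)
  show "a \<in> (\<lambda>k. a + k * l) ` {..<m}" if "a < a + m * l"
    using that by (auto intro!: image_eqI[of _ _ 0])
  fix p assume "p \<in> (\<lambda>k. a + k * l) ` {..<m}"
  then obtain k where k: "p = a + k * l" "k < m" by auto
  show "a \<le> p" "p < a + m * l" using k assms(1) by auto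
  have "q \<notin> (\<lambda>k. a + k * l) ` {..<m}" if "p < q" "q < p + l" for q
  proof
    assume "q \<in> (\<lambda>k. a + k * l) ` {..<m}"
    then obtain i where i: "q = a + i * l" by auto
    have "k * l < i * l" "i * l < Suc k * l" using that i k by auto
    then have "k < i" "i < Suc k" by (metis mult_less_cancel2)+
    then show False by simp
  qed
  moreover have "p + l \<in> (\<lambda>k. a + k * l) ` {..<m} \<or> p + l = a + m * l"
  proof (cases "Suc k < m")
    case True
    then show ?thesis using k by (auto intro!: disjI1 image_eqI[of _ _ "Suc k"])
  next
    case False
    then have "m = Suc k" using k by simp
    then show ?thesis using k by simp
  qed
  ultimately show "\<exists>l'\<in>\<Lambda> p. (p + l' \<in> (\<lambda>k. a + k * l) ` {..<m} \<or> p + l' = a + m * l) \<and>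
      (\<forall>q. p < q \<and> q < p + l' \<longrightarrow> q \<notin> (\<lambda>k. a + k * l) ` {..<m})"
    using assms(2)[OF k(2)] k(1) by blast
qed simp

text \<open>With \<open>n = q * N + r\<close> and \<open>r < N\<close>, the bound
  \<open>N * N \<le> n\<close> gives \<open>r \<le> q\<close>, so \<open>r\<close> of the
  \<open>q\<close> tiles of length \<open>N\<close> can be lengthened by one to absorb the
  remainder.\<close>

lemma tiled_filler:
  assumes N: "0 < N" and n: "N * N \<le> n" and \<Lambda>: "\<And>p. a \<le> p \<Longrightarrow> p < a + n \<Longrightarrow> {N, N + 1} \<subseteq> \<Lambda> p"
  shows "\<exists>\<tau>. tiled \<tau> \<Lambda> a (a + n)"
proof -
  define q r where "q = n div N" and "r = n mod N"
  have "r < N" "N \<le> q" using N n by (auto simp: q_def r_def less_eq_div_iff_mult_less_eq)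
  then have "r \<le> q" by simp
  have n_eq: "n = r * (N + 1) + (q - r) * N"
  proof -
    have "n = q * N + r" by (simp add: q_def r_def)
    also have "q = r + (q - r)" using \<open>r \<le> q\<close> by simp
    then have "q * N = r * N + (q - r) * N" by (metis add_mult_distrib)
    finally show ?thesis by simp
  qed
  have 1: "k * (N + 1) < n" if "k < r" for k
  proof -
    have "k * (N + 1) < r * (N + 1)" using that by (intro mult_strict_right_mono) auto
    then show ?thesis using n_eq by linarith
  qed
  have 2: "r * (N + 1) + k * N < n" if "k < q - r" for k
  proof -
    have "k * N < (q - r) * N" using that N by simp
    then show ?thesis using n_eq by linarith
  qed
  have t1: "tiled ((\<lambda>k. a + k * (N + 1)) ` {..<r}) \<Lambda> a (a + r * (N + 1))"
    using \<Lambda> 1 by (intro tiled_progression) auto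
  have t2: "tiled ((\<lambda>k. a + r * (N + 1) + k * N) ` {..<q - r}) \<Lambda> (a + r * (N + 1)) (a + r * (N + 1) + (q - r) * N)"
    using N \<Lambda> 2 by (intro tiled_progression) (auto simp: add.assoc)
  show ?thesis
    using tiled_Un[OF t1 t2] unfolding n_eq add.assoc by blast
qed

text \<open>The full blocks form an arithmetic progression of phase \<open>j\<close>, continued as
  long as at least \<open>N * N\<close> places remain at the upper end. Both end pieces are then
  long enough for \<open>tiled_filler\<close>, and both are shorter than \<open>N * N + L\<close>,
  which confines all other starting points to the ends.\<close>

lemma block_tiling_exists:
  fixes N L j h :: nat
  assumes N: "0 < N" and L: "0 < L" and j: "j < L" and h: "2 * (N * N) + L \<le> h"
  defines "full p \<equiv> N * N \<le> p \<and> p + L + N * N \<le> h \<and> (p - N * N) mod L = j"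
  shows "\<exists>\<tau>. tiled \<tau> (\<lambda>p. if full p then {L} else {N, N + 1}) 0 h \<and> (\<forall>p. full p \<longrightarrow> p \<in> \<tau>) \<and>
           (\<forall>p\<in>\<tau>. full p \<or> p < N * N + L \<or> h < p + L + N * N)"
proof -
  let ?\<Lambda> = "\<lambda>p. if full p then {L} else {N, N + 1}"
  define k where "k = (h - 2 * (N * N) - j) div L"
  define a where "a = N * N + j"
  define b where "b = a + k * L"
  have kL: "k * L \<le> h - 2 * (N * N) - j" "h - 2 * (N * N) - j < k * L + L"
    using dividend_less_div_times[OF L, of "h - 2 * (N * N) - j"] by (auto simp: k_def)
  have b: "b + N * N \<le> h" "h < b + N * N + L" using kL h j by (auto simp: a_def b_def)
  have "\<not> full p" if "p < a" for p
    using that j by (auto simp: full_def a_def)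
  then obtain \<tau>1 where 1: "tiled \<tau>1 ?\<Lambda> 0 a"
    using tiled_filler[of N "a" 0 ?\<Lambda>] N by (auto simp: a_def)
  have full_mid: "full (a + i * L)" if "i < k" for i
  proof -
    have "Suc i * L \<le> k * L" using that by (intro mult_le_mono1) simp
    then have "a + i * L + L \<le> b" by (simp add: b_def)
    then show ?thesis using b j by (auto simp: full_def a_def add.assoc)
  qed
  have 2: "tiled ((\<lambda>i. a + i * L) ` {..<k}) ?\<Lambda> a b"
    unfolding b_def using L full_mid by (intro tiled_progression) auto
  have 3: "\<exists>\<tau>. tiled \<tau> ?\<Lambda> b (b + (h - b))"
    using b N by (intro tiled_filler) (auto simp: full_def)
  then obtain \<tau>3 where 3: "tiled \<tau>3 ?\<Lambda> b h" using b by auto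
  let ?\<tau> = "\<tau>1 \<union> (\<lambda>i. a + i * L) ` {..<k} \<union> \<tau>3"
  have "tiled ?\<tau> ?\<Lambda> 0 h" using tiled_Un[OF tiled_Un[OF 1 2] 3] .
  moreover have "p \<in> ?\<tau>" if "full p" for p
  proof -
    have "p \<ge> a" using that \<open>\<And>p. p < a \<Longrightarrow> \<not> full p\<close> by (meson not_le)
    define i where "i = (p - N * N) div L"
    have "p - N * N = i * L + j" using that by (auto simp: full_def i_def)
    then have p: "p = a + i * L" using \<open>p \<ge> a\<close> by (auto simp: a_def)
    have "i < k"
    proof (rule ccontr)
      assume "\<not> i < k"
      then have "k * L \<le> i * L" by simp
      then have "b \<le> p" by (simp add: p b_def)
      then show False using that b by (auto simp: full_def)
    qed
    then show ?thesis using p by auto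
  qed
  moreover have "full p \<or> p < N * N + L \<or> h < p + L + N * N" if "p \<in> ?\<tau>" for p
  proof -
    consider "p \<in> \<tau>1" | "p \<in> (\<lambda>i. a + i * L) ` {..<k}" | "p \<in> \<tau>3" using \<open>p \<in> ?\<tau>\<close> by blast
    then show ?thesis
    proof cases
      case 1
      then have "p < a" using \<open>tiled \<tau>1 ?\<Lambda> 0 a\<close> by (auto simp: tiled_def)
      then show ?thesis using j by (simp add: a_def)
    next
      case 2
      then show ?thesis using full_mid by auto
    next
      case 3
      then have "b \<le> p" using \<open>tiled \<tau>3 ?\<Lambda> b h\<close> by (auto simp: tiled_def)
      then show ?thesis using b by simp
    qed
  qed
  ultimately show ?thesis by blast
qed

section \<open>Columns over a set with bounded return times\<close>

text \<open>The inverse identities hold at every point here, so orbits can be followed exactly; the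
  almost everywhere version is reduced to this one by discarding an invariant null set.\<close>

locale mp_system = prob_space M for M :: "'a measure" +
  fixes T S :: "'a \<Rightarrow> 'a"
  assumes T_measurable[measurable]: "T \<in> measurable M M"
    and S_measurable[measurable]: "S \<in> measurable M M"
    and ST: "x \<in> space M \<Longrightarrow> S (T x) = x"
    and TS: "x \<in> space M \<Longrightarrow> T (S x) = x"
    and distr_T: "distr M M T = M"
begin

lemma Tn_measurable[measurable]: "T ^^ n \<in> measurable M M"
  by (rule measurable_funpow) measurable

lemma Sn_measurable[measurable]: "S ^^ n \<in> measurable M M"
  by (rule measurable_funpow) measurable

lemma Tn_space[simp]: "x \<in> space M \<Longrightarrow> (T ^^ n) x \<in> space M"
  using measurable_space[OF Tn_measurable] .

lemma Sn_space[simp]: "x \<in> space M \<Longrightarrow> (S ^^ n) x \<in> space M"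
  using measurable_space[OF Sn_measurable] .

lemma STn[simp]: "x \<in> space M \<Longrightarrow> (S ^^ n) ((T ^^ n) x) = x"
  by (induction n) (auto simp: funpow_swap1 ST[OF Tn_space, simplified funpow_swap1])

lemma TSn[simp]: "x \<in> space M \<Longrightarrow> (T ^^ n) ((S ^^ n) x) = x"
  by (induction n) (auto simp: funpow_swap1 TS[OF Sn_space, simplified funpow_swap1])

lemma ST_le: assumes "x \<in> space M" "m \<le> n" shows "(S ^^ m) ((T ^^ n) x) = (T ^^ (n - m)) x"
proof -
  have "(T ^^ n) x = (T ^^ m) ((T ^^ (n - m)) x)"
    using assms(2) by (simp flip: funpow_add[THEN fun_cong, unfolded o_apply])
  then show ?thesis using assms(1) by simp
qed

lemma ST_ge: assumes "x \<in> space M" "n \<le> m" shows "(S ^^ m) ((T ^^ n) x) = (S ^^ (m - n)) x"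
proof -
  have "(S ^^ m) ((T ^^ n) x) = (S ^^ (m - n)) ((S ^^ n) ((T ^^ n) x))"
    using assms(2) by (simp flip: funpow_add[THEN fun_cong, unfolded o_apply])
  then show ?thesis using assms(1) by simp
qed

lemma TS_le: assumes "x \<in> space M" "m \<le> n" shows "(T ^^ m) ((S ^^ n) x) = (S ^^ (n - m)) x"
proof -
  have "(S ^^ n) x = (S ^^ m) ((S ^^ (n - m)) x)"
    using assms(2) by (simp flip: funpow_add[THEN fun_cong, unfolded o_apply])
  then show ?thesis using assms(1) by simp
qed

lemma TS_ge: assumes "x \<in> space M" "n \<le> m" shows "(T ^^ m) ((S ^^ n) x) = (T ^^ (m - n)) x"
proof -
  have "(T ^^ m) ((S ^^ n) x) = (T ^^ (m - n)) ((T ^^ n) ((S ^^ n) x))"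
    using assms(2) by (simp flip: funpow_add[THEN fun_cong, unfolded o_apply])
  then show ?thesis using assms(1) by simp
qed

lemma TT: "(T ^^ m) ((T ^^ n) x) = (T ^^ (m + n)) x"
  by (simp add: funpow_add)

lemma distr_Tn: "distr M M (T ^^ n) = M"
proof (induction n)
  case 0
  then show ?case by (simp add: distr_id2[unfolded id_def] id_def)
next
  case (Suc n)
  have "distr M M (T ^^ Suc n) = distr (distr M M (T ^^ n)) M T"
    by (subst distr_distr) (auto simp: o_def)
  then show ?case using Suc distr_T by (simp add: o_def)
qed

lemma distr_Sn: "distr M M (S ^^ n) = M"
proof -
  have "distr M M (S ^^ n) = distr (distr M M (T ^^ n)) M (S ^^ n)"
    by (simp add: distr_Tn)
  also have "\<dots> = distr M M (\<lambda>x. x)"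
    unfolding distr_distr[OF Sn_measurable Tn_measurable] by (rule distr_cong) auto
  finally show ?thesis by (simp add: distr_id2[unfolded id_def] id_def)
qed

lemma prob_Tn: "C \<in> sets M \<Longrightarrow> prob {x \<in> space M. (T ^^ n) x \<in> C} = prob C"
  using measure_distr[OF Tn_measurable, of C n] by (simp add: distr_Tn vimage_def Int_def conj_commute)

lemma prob_Sn: "C \<in> sets M \<Longrightarrow> prob {x \<in> space M. (S ^^ n) x \<in> C} = prob C"
  using measure_distr[OF Sn_measurable, of C n] by (simp add: distr_Sn vimage_def Int_def conj_commute)

lemma integral_Tn:
  fixes g :: "'a \<Rightarrow> real"
  assumes "g \<in> borel_measurable M"
  shows "(\<integral>x. g ((T ^^ n) x) \<partial>M) = (\<integral>x. g x \<partial>M)"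
  using integral_distr[OF Tn_measurable assms, of n] by (simp add: distr_Tn)

end

locale return_system = mp_system +
  fixes A
  assumes A_sets[measurable]: "A \<in> sets M"
    and past: "x \<in> space M \<Longrightarrow> \<exists>n. (S ^^ n) x \<in> A"
    and future: "x \<in> space M \<Longrightarrow> \<exists>n. (T ^^ n) x \<in> A"
begin

text \<open>
  In the column over \<open>A\<close> through \<open>x\<close>, \<open>pos x\<close> is the level of \<open>x\<close>; since \<open>rem x\<close> is always positive, the height
  of the column is \<open>pos x + rem x\<close>.
\<close>

definition pos :: "'a \<Rightarrow> nat" where "pos x = (LEAST n. (S ^^ n) x \<in> A)"

definition rem :: "'a \<Rightarrow> nat" where "rem x = (LEAST m. 0 < m \<and> (T ^^ m) x \<in> A)"

lemma pos_measurable[measurable]: "pos \<in> measurable M (count_space UNIV)"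
  unfolding pos_def by measurable

lemma rem_measurable[measurable]: "rem \<in> measurable M (count_space UNIV)"
  unfolding rem_def by measurable

lemma S_pos: "x \<in> space M \<Longrightarrow> (S ^^ pos x) x \<in> A"
  unfolding pos_def using past by (rule LeastI_ex)

lemma pos_le: "(S ^^ n) x \<in> A \<Longrightarrow> pos x \<le> n"
  unfolding pos_def by (rule Least_le)

lemma rem: assumes "x \<in> space M" shows "0 < rem x" "(T ^^ rem x) x \<in> A"
proof -
  obtain n where "(T ^^ n) (T x) \<in> A"
    using future[of "T x"] assms measurable_space[OF T_measurable] by blast
  then have "\<exists>m. 0 < m \<and> (T ^^ m) x \<in> A"
    by (intro exI[of _ "Suc n"]) (simp add: funpow_swap1)
  from LeastI_ex[OF this] show "0 < rem x" "(T ^^ rem x) x \<in> A" by (auto simp: rem_def)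
qed

lemma rem_le: "0 < n \<Longrightarrow> (T ^^ n) x \<in> A \<Longrightarrow> rem x \<le> n"
  unfolding rem_def by (rule Least_le) simp

text \<open>A visit to \<open>A\<close> fewer than \<open>pos x + i\<close> steps before
  \<open>(T ^^ i) x\<close> would be either a visit in the past of \<open>x\<close> more recent than
  \<open>pos x\<close>, or a visit strictly after \<open>x\<close> and before
  \<open>rem x\<close>.\<close>

lemma pos_T: assumes x: "x \<in> space M" and i: "i < rem x" shows "pos ((T ^^ i) x) = pos x + i"
  unfolding pos_def[of "(T ^^ i) x"]
proof (rule Least_equality)
  show "(S ^^ (pos x + i)) ((T ^^ i) x) \<in> A" using x S_pos[OF x] by (simp add: ST_ge)
  fix n assume n: "(S ^^ n) ((T ^^ i) x) \<in> A"
  show "pos x + i \<le> n"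
  proof (cases "i \<le> n")
    case True
    then show ?thesis using n x pos_le[of "n - i" x] by (simp add: ST_ge)
  next
    case False
    then show ?thesis using n x i rem_le[of "i - n" x] by (simp add: ST_le)
  qed
qed

lemma rem_T: assumes x: "x \<in> space M" and i: "i < rem x" shows "rem ((T ^^ i) x) = rem x - i"
  unfolding rem_def[of "(T ^^ i) x"]
proof (rule Least_equality)
  show "0 < rem x - i \<and> (T ^^ (rem x - i)) ((T ^^ i) x) \<in> A"
    using rem[OF x] i by (simp add: TT)
  fix n assume "0 < n \<and> (T ^^ n) ((T ^^ i) x) \<in> A"
  then show "rem x - i \<le> n" using rem_le[of "n + i" x] by (simp add: TT)
qed

lemma pos_eq_0: "x \<in> space M \<Longrightarrow> pos x = 0 \<longleftrightarrow> x \<in> A"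
  using S_pos[of x] pos_le[of 0 x] by auto

lemma rem_S_pos: assumes x: "x \<in> space M" shows "rem ((S ^^ pos x) x) = pos x + rem x"
  unfolding rem_def[of "(S ^^ pos x) x"]
proof (rule Least_equality)
  show "0 < pos x + rem x \<and> (T ^^ (pos x + rem x)) ((S ^^ pos x) x) \<in> A"
    using rem[OF x] x by (simp add: TS_ge)
  fix n assume n: "0 < n \<and> (T ^^ n) ((S ^^ pos x) x) \<in> A"
  show "pos x + rem x \<le> n"
  proof (cases "n \<le> pos x")
    case True
    then show ?thesis using n x pos_le[of "pos x - n" x] by (auto simp: TS_le)
  next
    case False
    then show ?thesis using n x rem_le[of "n - pos x" x] by (simp add: TS_ge)
  qed
qed

section \<open>Tower bases and their exchange along columns\<close>

text \<open>The two conditions say that the first return time to \<open>B\<close> is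
  \<open>N\<close> or \<open>N + 1\<close>. Containing \<open>A\<close> makes every column over
  \<open>A\<close> start afresh with a point of the base.\<close>

definition tower_base :: "nat \<Rightarrow> 'a set \<Rightarrow> bool" where
  "tower_base N B \<longleftrightarrow> B \<in> sets M \<and> A \<subseteq> B \<and>
    (\<forall>x\<in>B. (\<forall>i. 0 < i \<and> i < N \<longrightarrow> (T ^^ i) x \<notin> B) \<and> ((T ^^ N) x \<in> B \<or> (T ^^ (N + 1)) x \<in> B))"

text \<open>If the most recent visit were more than \<open>N\<close> steps back, its return after
  \<open>N\<close> or \<open>N + 1\<close> steps would be a more recent visit that is still not
  after \<open>x\<close>.\<close>

lemma base_past:
  assumes B: "tower_base N B" and N: "0 < N" and x: "x \<in> space M"
  shows "\<exists>i\<le>N. (S ^^ i) x \<in> B"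
proof -
  define n where "n = (LEAST n. (S ^^ n) x \<in> B)"
  have ex: "\<exists>n. (S ^^ n) x \<in> B" using past[OF x] B by (auto simp: tower_base_def)
  then have n: "(S ^^ n) x \<in> B" unfolding n_def by (rule LeastI_ex)
  have "n \<le> N"
  proof (rule ccontr)
    assume "\<not> n \<le> N"
    then have "N + 1 \<le> n" by simp
    have "(T ^^ N) ((S ^^ n) x) \<in> B \<or> (T ^^ (N + 1)) ((S ^^ n) x) \<in> B"
      using n B unfolding tower_base_def by blast
    then have "(S ^^ (n - N)) x \<in> B \<or> (S ^^ (n - (N + 1))) x \<in> B"
      using TS_le[OF x, of N n] TS_le[OF x, of "N + 1" n] \<open>N + 1 \<le> n\<close> by simp
    then have "n \<le> n - N \<or> n \<le> n - (N + 1)"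
      unfolding n_def using Least_le[of "\<lambda>n. (S ^^ n) x \<in> B"] by blast
    then show False using N \<open>N + 1 \<le> n\<close> by linarith
  qed
  then show ?thesis using n by blast
qed

text \<open>Membership may change only when the orbit enters \<open>A\<close>: these are the unions
  of whole columns over \<open>A\<close>.\<close>

definition column_set :: "'a set \<Rightarrow> bool" where
  "column_set Q \<longleftrightarrow> Q \<in> sets M \<and> (\<forall>x\<in>space M. T x \<notin> A \<longrightarrow> (T x \<in> Q \<longleftrightarrow> x \<in> Q))"

lemma column_set_Tn:
  assumes "column_set Q" "x \<in> space M" "\<And>j. 0 < j \<Longrightarrow> j \<le> i \<Longrightarrow> (T ^^ j) x \<notin> A"
  shows "(T ^^ i) x \<in> Q \<longleftrightarrow> x \<in> Q"
  using assms(3)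
proof (induction i)
  case (Suc i)
  have "T ((T ^^ i) x) \<notin> A" using Suc.prems[of "Suc i"] by simp
  then have "T ((T ^^ i) x) \<in> Q \<longleftrightarrow> (T ^^ i) x \<in> Q"
    using assms(1,2) unfolding column_set_def by simp
  then show ?case using Suc by simp
qed simp

text \<open>Until its next visit to \<open>A\<close> the orbit of \<open>x\<close> stays in
  \<open>Q\<close>, where \<open>B\<close> and \<open>C\<close> agree, and at that visit it lies in
  both. Hence the return of \<open>x\<close> to \<open>B\<close> is also its return to
  \<open>C\<close>.\<close>

lemma tower_base_mix_half:
  assumes B: "tower_base N B" and Q: "column_set Q"
    and C: "\<And>y. y \<in> Q \<Longrightarrow> y \<in> C \<longleftrightarrow> y \<in> B" "A \<subseteq> C" and x: "x \<in> B" "x \<in> Q"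
  shows "(\<forall>i. 0 < i \<and> i < N \<longrightarrow> (T ^^ i) x \<notin> C) \<and> ((T ^^ N) x \<in> C \<or> (T ^^ (N + 1)) x \<in> C)"
proof -
  have sp: "x \<in> space M" using x(1) B sets.sets_into_space by (auto simp: tower_base_def)
  have notB: "(T ^^ i) x \<notin> B" if "0 < i" "i < N" for i using B x that by (auto simp: tower_base_def)
  then have notA: "(T ^^ i) x \<notin> A" if "0 < i" "i < N" for i using B that by (auto simp: tower_base_def)
  have "(T ^^ i) x \<notin> C" if "0 < i" "i < N" for i
  proof -
    have "(T ^^ i) x \<in> Q" using column_set_Tn[OF Q sp, of i] notA that x by auto
    then show ?thesis using C notB that by blast
  qed
  moreover have "(T ^^ N) x \<in> C \<or> (T ^^ (N + 1)) x \<in> C"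
  proof (cases "(T ^^ N) x \<in> B")
    case True
    have "(T ^^ N) x \<in> Q" if "(T ^^ N) x \<notin> A"
      using column_set_Tn[OF Q sp, of N] notA that x by (metis nat_less_le)
    then show ?thesis using True C by blast
  next
    case False
    then have nA: "(T ^^ N) x \<notin> A" using B by (auto simp: tower_base_def)
    have inB: "(T ^^ (N + 1)) x \<in> B" using False B x by (auto simp: tower_base_def)
    have "(T ^^ (N + 1)) x \<in> Q" if "(T ^^ (N + 1)) x \<notin> A"
    proof -
      have "(T ^^ j) x \<notin> A" if "0 < j" "j \<le> N + 1" for j
        using nA notA that \<open>(T ^^ (N + 1)) x \<notin> A\<close>
        by (cases "j = N + 1"; cases "j = N") auto
      then show ?thesis using column_set_Tn[OF Q sp, of "N + 1"] x by auto
    qed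
    then show ?thesis using inB C by blast
  qed
  ultimately show ?thesis by blast
qed

text \<open>A column that follows one base may be succeeded by a column that follows the other,
  because both bases contain \<open>A\<close>. The complement of \<open>Q\<close> is again a column
  set, so the previous lemma covers both halves.\<close>

lemma base_mix:
  assumes B0: "tower_base N B0" and B1: "tower_base N B1" and Q: "column_set Q"
  shows "tower_base N ((B1 \<inter> Q) \<union> (B0 - Q))" (is "tower_base N ?B")
  unfolding tower_base_def
proof (intro conjI)
  have Q': "column_set (space M - Q)"
    using Q measurable_space[OF T_measurable] by (auto simp: column_set_def)
  show "?B \<in> sets M" using B0 B1 Q by (auto simp: tower_base_def column_set_def)
  show A: "A \<subseteq> ?B" using B0 B1 by (auto simp: tower_base_def)
  show "\<forall>x\<in>?B. (\<forall>i. 0 < i \<and> i < N \<longrightarrow> (T ^^ i) x \<notin> ?B) \<and> ((T ^^ N) x \<in> ?B \<or> (T ^^ (N + 1)) x \<in> ?B)"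
  proof
    fix x assume x: "x \<in> ?B"
    show "(\<forall>i. 0 < i \<and> i < N \<longrightarrow> (T ^^ i) x \<notin> ?B) \<and> ((T ^^ N) x \<in> ?B \<or> (T ^^ (N + 1)) x \<in> ?B)"
    proof (cases "x \<in> Q")
      case True
      then show ?thesis using x by (intro tower_base_mix_half[OF B1 Q _ A]) auto
    next
      case False
      have "x \<in> space M" using x B0 B1 sets.sets_into_space by (auto simp: tower_base_def)
      then show ?thesis using False x by (intro tower_base_mix_half[OF B0 Q' _ A]) auto
    qed
  qed
qed

text \<open>Each level \<open>n\<close> is moved down to the foot of its column by invariance. The
  result involves \<open>D\<close> only through its intersections with finitely many sets, which is
  where the bound \<open>H\<close> is needed.\<close>

lemma prob_column_set:
  assumes H: "\<And>x. x \<in> space M \<Longrightarrow> pos x < H" and [measurable]: "D \<in> sets M" "R \<in> sets M"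
  shows "prob (R \<inter> {x \<in> space M. (S ^^ pos x) x \<in> D}) =
    (\<Sum>n<H. prob (D \<inter> {y \<in> space M. pos ((T ^^ n) y) = n \<and> (T ^^ n) y \<in> R}))"
proof -
  define F where "F n = {x \<in> space M. x \<in> R \<and> pos x = n \<and> (S ^^ n) x \<in> D}" for n
  have [measurable]: "F n \<in> sets M" for n unfolding F_def by measurable
  have "R \<inter> {x \<in> space M. (S ^^ pos x) x \<in> D} = (\<Union>n<H. F n)"
    using H by (auto simp: F_def)
  also have "prob \<dots> = (\<Sum>n<H. prob (F n))"
    by (intro finite_measure_finite_Union) (auto simp: disjoint_family_on_def F_def)
  also have "\<dots> = (\<Sum>n<H. prob (D \<inter> {y \<in> space M. pos ((T ^^ n) y) = n \<and> (T ^^ n) y \<in> R}))"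
  proof (intro sum.cong refl)
    fix n
    have "{x \<in> space M. (T ^^ n) x \<in> F n} = D \<inter> {y \<in> space M. pos ((T ^^ n) y) = n \<and> (T ^^ n) y \<in> R}"
      using sets.sets_into_space[OF assms(2)] by (auto simp: F_def)
    then show "prob (F n) = prob (D \<inter> {y \<in> space M. pos ((T ^^ n) y) = n \<and> (T ^^ n) y \<in> R})"
      using prob_Tn[of "F n" n] by simp
  qed
  finally show ?thesis .
qed

text \<open>Take the columns whose foot lies in \<open>D\<close>, with \<open>D\<close> occupying
  the proportion \<open>t\<close> of each of the finitely many sets that arise when the members of
  \<open>\<R>\<close> are cut into levels and moved down.\<close>

lemma column_set_exists:
  assumes H: "\<And>x. x \<in> space M \<Longrightarrow> pos x < H" and div: "divisible_measure M"
    and fin: "finite \<R>" and R: "\<R> \<subseteq> sets M" and t: "0 \<le> t" "t \<le> (1::real)"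
  shows "\<exists>Q. column_set Q \<and> (\<forall>R\<in>\<R>. prob (R \<inter> Q) = t * prob R)"
proof -
  define F where "F R n = {y \<in> space M. pos ((T ^^ n) y) = n \<and> (T ^^ n) y \<in> R}" for R n
  have F: "F R n \<in> sets M" if [measurable]: "R \<in> sets M" for R n
    unfolding F_def by measurable
  let ?\<F> = "(\<lambda>(R, n). F R n) ` (\<R> \<times> {..<H})"
  have "finite ?\<F>" "?\<F> \<subseteq> sets M" using fin R F by auto
  then obtain D where D[measurable]: "D \<in> sets M" and D_indep: "\<forall>C\<in>?\<F>. prob (D \<inter> C) = t * prob C"
    using independent_set_exists[OF div _ _ t] by blast
  have DF: "prob (D \<inter> F R n) = t * prob (F R n)" if "R \<in> \<R>" "n < H" for R n
    using D_indep that by blast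
  define Q where "Q = {x \<in> space M. (S ^^ pos x) x \<in> D}"
  have Qeq: "Q = {x \<in> space M. \<exists>n. pos x = n \<and> (S ^^ n) x \<in> D}" by (auto simp: Q_def)
  have "Q \<in> sets M" unfolding Qeq by measurable
  moreover have "T x \<in> Q \<longleftrightarrow> x \<in> Q" if x: "x \<in> space M" "T x \<notin> A" for x
  proof -
    have "1 < rem x" using rem[OF x(1)] x(2) by (cases "rem x = 1") auto
    then have "pos (T x) = Suc (pos x)" using pos_T[OF x(1), of 1] by simp
    then have "(S ^^ pos (T x)) (T x) = (S ^^ pos x) x"
      using ST_ge[OF x(1), of 1 "Suc (pos x)"] by simp
    then show ?thesis using x measurable_space[OF T_measurable] by (auto simp: Q_def)
  qed
  moreover have "prob (R \<inter> Q) = t * prob R" if "R \<in> \<R>" for R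
  proof -
    have Rs: "R \<in> sets M" using that R by auto
    have "prob (R \<inter> Q) = (\<Sum>n<H. prob (D \<inter> F R n))"
      unfolding Q_def F_def by (rule prob_column_set[OF H D Rs])
    \<comment> \<open>Writing the right-hand side with \<open>space M\<close> in the role of
      \<open>D\<close> allows the same level decomposition to be read backwards, which yields
      \<open>prob R\<close>.\<close>
    also have "\<dots> = t * (\<Sum>n<H. prob (space M \<inter> F R n))"
      unfolding sum_distrib_left using DF[OF that] F[OF Rs] by (intro sum.cong) auto
    also have "(\<Sum>n<H. prob (space M \<inter> F R n)) = prob (R \<inter> {x \<in> space M. (S ^^ pos x) x \<in> space M})"
      unfolding F_def by (rule prob_column_set[OF H sets.top Rs, symmetric])
    also have "R \<inter> {x \<in> space M. (S ^^ pos x) x \<in> space M} = R"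
      using sets.sets_into_space[OF Rs] by auto
    finally show ?thesis .
  qed
  ultimately show ?thesis unfolding column_set_def by blast
qed

text \<open>The sets of points that were in \<open>A\<close> exactly \<open>i\<close> steps ago, for
  \<open>i < K\<close>, are pairwise disjoint and all have the measure of \<open>A\<close>.\<close>

lemma prob_A_le:
  assumes K: "0 < K" and gap: "\<And>x i. x \<in> A \<Longrightarrow> 0 < i \<Longrightarrow> i < K \<Longrightarrow> (T ^^ i) x \<notin> A"
  shows "prob A \<le> 1 / real K"
proof -
  define F where "F i = {x \<in> space M. (S ^^ i) x \<in> A}" for i
  have F: "F i \<in> sets M" for i unfolding F_def by measurable
  have lt: "False" if "x \<in> F i" "x \<in> F j" "i < j" "j < K" for x i j
  proof -
    have x: "x \<in> space M" using that by (simp add: F_def)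
    have "(T ^^ (j - i)) ((S ^^ j) x) = (S ^^ i) x" using TS_le[OF x, of "j - i" j] that by simp
    moreover have "j - i < K" using that by linarith
    ultimately show False using gap[of "(S ^^ j) x" "j - i"] that by (simp add: F_def)
  qed
  have "disjoint_family_on F {..<K}"
    unfolding disjoint_family_on_def
  proof (intro ballI impI)
    fix i j assume ij: "i \<in> {..<K}" "j \<in> {..<K}" "i \<noteq> j"
    then consider "i < j" | "j < i" by linarith
    then show "F i \<inter> F j = {}" using lt[of _ i j] lt[of _ j i] ij by cases auto
  qed
  then have "(\<Sum>i<K. prob (F i)) = prob (\<Union>i<K. F i)"
    using F by (intro finite_measure_finite_Union[symmetric]) auto
  also have "\<dots> \<le> 1" by simp
  finally show ?thesis using K prob_Sn[OF A_sets] by (simp add: F_def field_simps)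
qed

lemma prob_pos_less: "prob {x \<in> space M. pos x < m} \<le> m * prob A"
proof -
  have "prob {x \<in> space M. pos x < m} \<le> prob (\<Union>i<m. {x \<in> space M. (S ^^ i) x \<in> A})"
    using S_pos by (intro finite_measure_mono) auto
  also have "\<dots> \<le> (\<Sum>i<m. prob {x \<in> space M. (S ^^ i) x \<in> A})"
    by (intro finite_measure_subadditive_finite) auto
  finally show ?thesis by (simp add: prob_Sn)
qed

lemma prob_rem_less: "prob {x \<in> space M. rem x < m} \<le> m * prob A"
proof -
  have "prob {x \<in> space M. rem x < m} \<le> prob (\<Union>i<m. {x \<in> space M. (T ^^ i) x \<in> A})"
    using rem by (intro finite_measure_mono) auto
  also have "\<dots> \<le> (\<Sum>i<m. prob {x \<in> space M. (T ^^ i) x \<in> A})"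
    by (intro finite_measure_subadditive_finite) auto
  finally show ?thesis by (simp add: prob_Tn)
qed


section \<open>Bases with small integrals\<close>

text \<open>\<open>DL\<close> consists of the starting points of blocks of length \<open>2N + 1\<close>, which are split as \<open>N, N + 1\<close> on \<open>W\<close>
  and as \<open>N + 1, N\<close> elsewhere.\<close>

lemma base_switch:
  fixes f :: "'a \<Rightarrow> real"
  assumes N: "0 < N" and [measurable]: "D \<in> sets M" "DL \<in> sets M" "W \<in> sets M" "f \<in> borel_measurable M"
    and sub: "A \<subseteq> D" "DL \<subseteq> D"
    and step: "\<And>x. x \<in> D \<Longrightarrow> \<exists>l\<in>(if x \<in> DL then {2 * N + 1} else {N, N + 1}).
                 (T ^^ l) x \<in> D \<and> (\<forall>i. 0 < i \<and> i < l \<longrightarrow> (T ^^ i) x \<notin> D)"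
    and bnd: "\<And>x. x \<in> space M \<Longrightarrow> \<bar>f x\<bar> \<le> F"
  shows "\<exists>B. tower_base N B \<and> (\<integral>x. f x * indicator B x \<partial>M) =
    (\<integral>x. f x * indicator D x + (if x \<in> W then f ((T ^^ N) x) else f ((T ^^ (N + 1)) x)) * indicator DL x \<partial>M)"
proof -
  obtain l where l: "\<And>x. x \<in> D \<Longrightarrow> l x \<in> (if x \<in> DL then {2 * N + 1} else {N, N + 1})"
    and l_next: "\<And>x. x \<in> D \<Longrightarrow> (T ^^ l x) x \<in> D"
    and l_gap: "\<And>x i. x \<in> D \<Longrightarrow> 0 < i \<Longrightarrow> i < l x \<Longrightarrow> (T ^^ i) x \<notin> D"
    using step by metis
  \<comment> \<open>\<open>B1\<close> and \<open>B2\<close> are the points to be inserted into the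
    blocks: the image of \<open>DL \<inter> W\<close> under \<open>T^N\<close> and that of
    \<open>DL - W\<close> under \<open>T^(N+1)\<close>.\<close>
  define B1 where "B1 = {x \<in> space M. (S ^^ N) x \<in> DL \<inter> W}"
  define B2 where "B2 = {x \<in> space M. (S ^^ (N + 1)) x \<in> DL - W}"
  define B where "B = D \<union> B1 \<union> B2"
  \<comment> \<open>The offsets, counted from the starting point of the tile at \<open>x\<close>, at
    which \<open>B\<close> has points.\<close>
  define offs where "offs x = (if x \<in> DL then (if x \<in> W then {0, N} else {0, N + 1}) else {0})" for x
  have sp: "x \<in> space M" if "x \<in> D" for x using that sets.sets_into_space[OF \<open>D \<in> sets M\<close>] by blast
  have [measurable]: "B1 \<in> sets M" "B2 \<in> sets M" unfolding B1_def B2_def by measurable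
  \<comment> \<open>A point determines its tile and its offset there: after cancelling iterates, a
    positive difference of offsets would be a return to \<open>D\<close> inside the tile of
    \<open>z\<close>.\<close>
  have uniq_le: "x = z \<and> a = b" if "x \<in> D" "z \<in> D" "b < l z" "(T ^^ a) x = (T ^^ b) z" "a \<le> b" for x z a b
  proof -
    have "(S ^^ a) ((T ^^ a) x) = (S ^^ a) ((T ^^ b) z)" using that by simp
    then have "x = (T ^^ (b - a)) z"
      unfolding STn[OF sp[OF that(1)]] ST_le[OF sp[OF that(2)] that(5)] .
    moreover have "b - a = 0"
    proof (rule ccontr)
      assume "b - a \<noteq> 0"
      then have "(T ^^ (b - a)) z \<notin> D" using that l_gap[of z "b - a"] by auto
      then show False using calculation that by simp
    qed
    ultimately show ?thesis using that by simp
  qed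
  have uniq: "x = z \<and> a = b" if "x \<in> D" "z \<in> D" "a < l x" "b < l z" "(T ^^ a) x = (T ^^ b) z" for x z a b
    using uniq_le[of x z b a] uniq_le[of z x a b] that by (cases "a \<le> b") auto
  have l_pos: "0 < l x" if "x \<in> D" for x using l[OF that] N by (auto split: if_splits)
  have l_DL: "l x = 2 * N + 1" if "x \<in> DL" for x using l[of x] that sub by auto
  have B1_iff: "(T ^^ a) x \<in> B1 \<longleftrightarrow> x \<in> DL \<and> x \<in> W \<and> a = N" if x: "x \<in> D" "a < l x" for x a
  proof
    assume Tx: "(T ^^ a) x \<in> B1"
    define z where "z = (S ^^ N) ((T ^^ a) x)"
    have z: "z \<in> DL" "z \<in> W" using Tx by (auto simp: B1_def z_def)
    have "(T ^^ a) x = (T ^^ N) z" using sp[OF x(1)] by (simp add: z_def)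
    moreover have "z \<in> D" "N < l z" using z sub l_DL[of z] by auto
    ultimately have "x = z \<and> a = N" using uniq[OF x(1) _ x(2)] by blast
    then show "x \<in> DL \<and> x \<in> W \<and> a = N" using z by simp
  qed (use sp x in \<open>auto simp: B1_def\<close>)
  have B2_iff: "(T ^^ a) x \<in> B2 \<longleftrightarrow> x \<in> DL \<and> x \<notin> W \<and> a = N + 1" if x: "x \<in> D" "a < l x" for x a
  proof
    assume Tx: "(T ^^ a) x \<in> B2"
    define z where "z = (S ^^ (N + 1)) ((T ^^ a) x)"
    have z: "z \<in> DL" "z \<notin> W" using Tx unfolding B2_def z_def by blast+
    have "(T ^^ a) x = (T ^^ (N + 1)) z"
      unfolding z_def using TSn[OF Tn_space[OF sp[OF x(1)]], of "N + 1" a] by (rule sym)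
    moreover have "z \<in> D" "N + 1 < l z" using z sub l_DL[of z] N by auto
    ultimately have "x = z \<and> a = N + 1" using uniq[OF x(1) _ x(2)] by blast
    then show "x \<in> DL \<and> x \<notin> W \<and> a = N + 1" using z by simp
  next
    assume "x \<in> DL \<and> x \<notin> W \<and> a = N + 1"
    then show "(T ^^ a) x \<in> B2" using STn[of x "N + 1"] Tn_space[of x "N + 1"] sp x by (simp add: B2_def del: funpow.simps)
  qed
  have D_iff: "(T ^^ a) x \<in> D \<longleftrightarrow> a = 0" if x: "x \<in> D" "a < l x" for x a
    using l_gap[OF x(1) _ x(2)] x by (cases "a = 0") auto
  have B_iff: "(T ^^ a) x \<in> B \<longleftrightarrow> a \<in> offs x" if x: "x \<in> D" "a < l x" for x a
    unfolding B_def Un_iff B1_iff[OF x] B2_iff[OF x] D_iff[OF x] by (auto simp: offs_def)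
  have B_rep: "\<exists>z\<in>D. \<exists>a<l z. y = (T ^^ a) z" if y: "y \<in> B" for y
  proof -
    consider "y \<in> D" | "y \<in> B1" | "y \<in> B2" using y by (auto simp: B_def)
    then show ?thesis
    proof cases
      case 1
      then show ?thesis using l_pos by (intro bexI[of _ y] exI[of _ 0]) auto
    next
      case 2
      then have "(S ^^ N) y \<in> DL" "y = (T ^^ N) ((S ^^ N) y)" by (auto simp: B1_def)
      then show ?thesis using l_DL[of "(S ^^ N) y"] sub by (intro bexI[of _ "(S ^^ N) y"] exI[of _ N]) auto
    next
      case 3
      then have "(S ^^ (N + 1)) y \<in> DL" "y = (T ^^ (N + 1)) ((S ^^ (N + 1)) y)"
        using TSn[of y "N + 1"] by (auto simp: B2_def simp del: funpow.simps)
      then show ?thesis using l_DL[of "(S ^^ (N + 1)) y"] sub N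
        by (intro bexI[of _ "(S ^^ (N + 1)) y"] exI[of _ "N + 1"]) auto
    qed
  qed
  have "tower_base N B"
    unfolding tower_base_def
  proof (intro conjI ballI)
    show "B \<in> sets M" unfolding B_def by measurable
    show "A \<subseteq> B" using sub by (auto simp: B_def)
    fix y assume y: "y \<in> B"
    then obtain x a where x: "x \<in> D" "a < l x" and yx: "y = (T ^^ a) x" using B_rep by blast
    have a: "a \<in> offs x" using B_iff[OF x] y yx by simp
    have Ty: "(T ^^ i) y = (T ^^ (a + i)) x" for i by (simp add: yx TT add.commute)
    have Ty': "(T ^^ i) y = (T ^^ (a + i - l x)) ((T ^^ l x) x)" if "l x \<le> a + i" for i
      using that by (simp add: Ty TT)
    have lx: "l x = (if x \<in> DL then 2 * N + 1 else l x)" "x \<notin> DL \<Longrightarrow> l x = N \<or> l x = N + 1"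
      using l[OF x(1)] by auto
    show "\<forall>i. 0 < i \<and> i < N \<longrightarrow> (T ^^ i) y \<notin> B"
    proof (intro allI impI)
      fix i assume i: "0 < i \<and> i < N"
      show "(T ^^ i) y \<notin> B"
      \<comment> \<open>Every offset in \<open>offs x\<close> is at distance at least
        \<open>N\<close> from the end of the tile and from other offsets. In fewer than
        \<open>N\<close> steps the orbit either stays in the tile or reaches an offset strictly
        between \<open>0\<close> and \<open>N\<close> in the next one, where \<open>B\<close> has no
        points.\<close>
      proof (cases "a + i < l x")
        case True
        then show ?thesis unfolding Ty B_iff[OF x(1) True] using a i by (auto simp: offs_def split: if_splits)
      next
        case False
        let ?z = "(T ^^ l x) x" and ?b = "a + i - l x"
        have z: "?z \<in> D" using l_next x by simp
        have "N \<le> l ?z" using l[OF z] by (auto split: if_splits)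
        moreover have "?b < N" using x i by linarith
        ultimately have b: "?b < l ?z" by simp
        have "a + i \<noteq> l x" using a i lx by (auto simp: offs_def split: if_splits)
        then have "?b \<noteq> 0" using False by simp
        then have "?b \<notin> offs ?z" using \<open>?b < N\<close> by (auto simp: offs_def)
        then show ?thesis using Ty'[of i] B_iff[OF z b] False by simp
      qed
    qed
    have zB: "(T ^^ l x) x \<in> B" using l_next x by (auto simp: B_def)
    show "(T ^^ N) y \<in> B \<or> (T ^^ (N + 1)) y \<in> B"
    proof (cases "x \<in> DL")
      case True
      then have lx: "l x = 2 * N + 1" by (rule l_DL)
      \<comment> \<open>From offset \<open>0\<close> the next point of \<open>B\<close> is the
        inserted one; from an inserted point it is the start of the next tile, \<open>N + 1\<close>
        or \<open>N\<close> steps ahead.\<close>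
      consider "a = 0" | "a = N" "x \<in> W" | "a = N + 1" "x \<notin> W"
        using a True by (auto simp: offs_def split: if_splits)
      then show ?thesis
      proof cases
        case 1
        have "N < l x" "N + 1 < l x" using lx N by auto
        then have "(T ^^ N) x \<in> B \<longleftrightarrow> x \<in> W" "(T ^^ (N + 1)) x \<in> B \<longleftrightarrow> x \<notin> W"
          using B_iff[OF x(1), of N] B_iff[OF x(1), of "N + 1"] True N
          by (auto simp: offs_def simp del: funpow.simps)
        then show ?thesis using 1 yx by auto
      next
        case 2
        then have "(T ^^ (N + 1)) y = (T ^^ l x) x" unfolding Ty lx by (simp add: mult_2)
        then show ?thesis using zB by simp
      next
        case 3
        then have "(T ^^ N) y = (T ^^ l x) x" unfolding Ty lx by (simp add: mult_2)
        then show ?thesis using zB by simp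
      qed
    next
      case False
      then have "a = 0" using a by (simp add: offs_def)
      then show ?thesis using zB lx(2)[OF False] yx by auto
    qed
  qed
  moreover have "(\<integral>x. f x * indicator B x \<partial>M) =
    (\<integral>x. f x * indicator D x + (if x \<in> W then f ((T ^^ N) x) else f ((T ^^ (N + 1)) x)) * indicator DL x \<partial>M)"
  proof -
    have disj: "D \<inter> B1 = {}" "D \<inter> B2 = {}" "B1 \<inter> B2 = {}"
    proof -
      have "y \<notin> B1 \<and> y \<notin> B2" if "y \<in> D" for y
        using B1_iff[of y 0] B2_iff[of y 0] l_pos[of y] that N by auto
      then show "D \<inter> B1 = {}" "D \<inter> B2 = {}" by auto
      have "y \<notin> B2" if "y \<in> B1" for y
        using B_rep[of y] B1_iff B2_iff that by (auto simp: B_def)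
      then show "B1 \<inter> B2 = {}" by auto
    qed
    have int: "integrable M g" if "g \<in> borel_measurable M" "\<And>x. x \<in> space M \<Longrightarrow> \<bar>g x\<bar> \<le> F" for g :: "'a \<Rightarrow> real"
      using that by (intro integrable_const_bound[of _ F]) auto
    have F: "0 \<le> F" using bnd not_empty by (meson abs_ge_zero all_not_in_conv order_trans)
    have ii: "integrable M (\<lambda>x. g x * indicator E x)"
      if "g \<in> borel_measurable M" "\<And>x. x \<in> space M \<Longrightarrow> \<bar>g x\<bar> \<le> F" "E \<in> sets M" for g :: "'a \<Rightarrow> real" and E
      using that F by (intro int) (auto simp: indicator_def)
    have fT: "\<bar>f ((T ^^ n) x)\<bar> \<le> F" if "x \<in> space M" for n x using bnd that by simp
    have "(\<integral>x. f x * indicator B x \<partial>M) =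
        (\<integral>x. f x * indicator D x + f x * indicator B1 x + f x * indicator B2 x \<partial>M)"
      using disj by (intro Bochner_Integration.integral_cong) (auto simp: B_def indicator_def)
    also have "\<dots> = (\<integral>x. f x * indicator D x \<partial>M) + (\<integral>x. f x * indicator B1 x \<partial>M) + (\<integral>x. f x * indicator B2 x \<partial>M)"
      using ii bnd by simp
    \<comment> \<open>Invariance of the measure moves the integral over the inserted points back to
      the starting points of their blocks.\<close>
    also have "(\<integral>x. f x * indicator B1 x \<partial>M) = (\<integral>x. f ((T ^^ N) x) * indicator B1 ((T ^^ N) x) \<partial>M)"
      by (rule integral_Tn[symmetric]) measurable
    also have "\<dots> = (\<integral>x. f ((T ^^ N) x) * indicator (DL \<inter> W) x \<partial>M)"
      by (intro Bochner_Integration.integral_cong) (auto simp: B1_def indicator_def)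
    also have "(\<integral>x. f x * indicator B2 x \<partial>M) = (\<integral>x. f ((T ^^ (N + 1)) x) * indicator B2 ((T ^^ (N + 1)) x) \<partial>M)"
      by (rule integral_Tn[symmetric]) measurable
    also have "\<dots> = (\<integral>x. f ((T ^^ (N + 1)) x) * indicator (DL - W) x \<partial>M)"
      using STn[of _ "N + 1"] Tn_space[of _ "N + 1"]
      by (intro Bochner_Integration.integral_cong) (auto simp: B2_def indicator_def simp del: funpow.simps)
    also have "(\<integral>x. f x * indicator D x \<partial>M) + (\<integral>x. f ((T ^^ N) x) * indicator (DL \<inter> W) x \<partial>M) +
        (\<integral>x. f ((T ^^ (N + 1)) x) * indicator (DL - W) x \<partial>M) =
        (\<integral>x. f x * indicator D x + f ((T ^^ N) x) * indicator (DL \<inter> W) x + f ((T ^^ (N + 1)) x) * indicator (DL - W) x \<partial>M)"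
      using ii[of f D] ii[of "\<lambda>x. f ((T ^^ N) x)" "DL \<inter> W"] ii[of "\<lambda>x. f ((T ^^ (N + 1)) x)" "DL - W"] bnd fT[of _ N] fT[of _ "N + 1"]
      by (simp del: funpow.simps)
    also have "\<dots> = (\<integral>x. f x * indicator D x + (if x \<in> W then f ((T ^^ N) x) else f ((T ^^ (N + 1)) x)) * indicator DL x \<partial>M)"
      by (intro Bochner_Integration.integral_cong) (auto simp: indicator_def)
    finally show ?thesis .
  qed
  ultimately show ?thesis by blast
qed

lemma height_ge:
  assumes gap: "\<And>x i. x \<in> A \<Longrightarrow> 0 < i \<Longrightarrow> i < K \<Longrightarrow> (T ^^ i) x \<notin> A" and x: "x \<in> space M"
  shows "K \<le> pos x + rem x"
proof (rule ccontr)
  assume "\<not> K \<le> pos x + rem x"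
  then show False
    using gap[of "(S ^^ pos x) x" "pos x + rem x"] S_pos[OF x] rem(1)[OF x]
      rem(2)[of "(S ^^ pos x) x"] x by (simp add: rem_S_pos)
qed

text \<open>The two ends of the columns, where the tilings contain filler and the contribution to
  the integral is only bounded crudely.\<close>

definition margin :: "nat \<Rightarrow> 'a set" where
  "margin m = {x \<in> space M. pos x < m \<or> rem x < m}"

text \<open>One tiling is chosen for each height \<open>h\<close> and copied to all columns of that
  height, so membership in \<open>D\<close> and \<open>DL\<close> depends only on \<open>pos\<close>
  and \<open>rem\<close> and measurability is immediate. Splitting each block at the point with the
  smaller value of \<open>f\<close> produces the minimum \<open>m\<close>.\<close>

lemma block_base_exists:
  fixes f :: "'a \<Rightarrow> real"
  defines "m N x \<equiv> min (f ((T ^^ N) x)) (f ((T ^^ (N + 1)) x))"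
  assumes N: "0 < N" and j: "j < 2 * N + 1" and K: "2 * (N * N) + (2 * N + 1) \<le> K"
    and gap: "\<And>x i. x \<in> A \<Longrightarrow> 0 < i \<Longrightarrow> i < K \<Longrightarrow> (T ^^ i) x \<notin> A"
    and [measurable]: "f \<in> borel_measurable M"
    and bnd: "\<And>x. x \<in> space M \<Longrightarrow> \<bar>f x\<bar> \<le> F"
  shows "\<exists>B D DL. tower_base N B \<and> D \<in> sets M \<and> DL \<in> sets M \<and>
    (\<integral>x. f x * indicator B x \<partial>M) = (\<integral>x. f x * indicator D x + m N x * indicator DL x \<partial>M) \<and>
    DL \<subseteq> D \<and> D \<subseteq> DL \<union> margin (N * N + (2 * N + 1)) \<and>
    (\<forall>x\<in>space M - margin (N * N + (2 * N + 1)). x \<in> DL \<longleftrightarrow> (pos x - N * N) mod (2 * N + 1) = j)"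
proof -
  define L where "L = 2 * N + 1"
  define full where "full h p \<longleftrightarrow> N * N \<le> p \<and> p + L + N * N \<le> h \<and> (p - N * N) mod L = j" for h p
  have "\<forall>h. \<exists>\<tau>. K \<le> h \<longrightarrow> tiled \<tau> (\<lambda>p. if full h p then {L} else {N, N + 1}) 0 h \<and> (\<forall>p. full h p \<longrightarrow> p \<in> \<tau>) \<and>
           (\<forall>p\<in>\<tau>. full h p \<or> p < N * N + L \<or> h < p + L + N * N)"
  proof
    fix h
    show "\<exists>\<tau>. K \<le> h \<longrightarrow> tiled \<tau> (\<lambda>p. if full h p then {L} else {N, N + 1}) 0 h \<and> (\<forall>p. full h p \<longrightarrow> p \<in> \<tau>) \<and>
           (\<forall>p\<in>\<tau>. full h p \<or> p < N * N + L \<or> h < p + L + N * N)"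
    proof (cases "K \<le> h")
      case True
      then show ?thesis
        using block_tiling_exists[of N L j h] N j K unfolding full_def L_def by auto
    qed simp
  qed
  then obtain \<tau> where
    tiled: "\<And>h. K \<le> h \<Longrightarrow> tiled (\<tau> h) (\<lambda>p. if full h p then {L} else {N, N + 1}) 0 h"
    and full_in: "\<And>h p. K \<le> h \<Longrightarrow> full h p \<Longrightarrow> p \<in> \<tau> h"
    and in_full: "\<And>h p. K \<le> h \<Longrightarrow> p \<in> \<tau> h \<Longrightarrow> full h p \<or> p < N * N + L \<or> h < p + L + N * N"
    by metis
  define D where "D = {x \<in> space M. pos x \<in> \<tau> (pos x + rem x)}"
  define DL where "DL = {x \<in> space M. full (pos x + rem x) (pos x)}"
  define W where "W = {x \<in> space M. f ((T ^^ N) x) \<le> f ((T ^^ (N + 1)) x)}"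
  have [measurable]: "D \<in> sets M"
  proof -
    have "D = {x \<in> space M. \<exists>p h. pos x = p \<and> rem x = h \<and> p \<in> \<tau> (p + h)}" by (auto simp: D_def)
    then show ?thesis by simp
  qed
  have [measurable]: "DL \<in> sets M"
  proof -
    have "DL = {x \<in> space M. \<exists>p h. pos x = p \<and> rem x = h \<and> full (p + h) p}" by (auto simp: DL_def)
    then show ?thesis by simp
  qed
  have [measurable]: "W \<in> sets M" unfolding W_def by measurable
  have h_ge: "K \<le> pos x + rem x" if "x \<in> space M" for x by (rule height_ge[OF gap that])
  have A_D: "x \<in> D" if "x \<in> A" for x
  proof -
    have x: "x \<in> space M" using that sets.sets_into_space[OF A_sets] by blast
    have "pos x = 0" using pos_eq_0[OF x] that by simp
    moreover have "0 \<in> \<tau> (pos x + rem x)"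
      using tiled[OF h_ge[OF x]] rem(1)[OF x] by (simp add: tiled_def)
    ultimately show ?thesis using x by (simp add: D_def)
  qed
  have step: "\<exists>l\<in>(if x \<in> DL then {2 * N + 1} else {N, N + 1}).
      (T ^^ l) x \<in> D \<and> (\<forall>i. 0 < i \<and> i < l \<longrightarrow> (T ^^ i) x \<notin> D)" if "x \<in> D" for x
  proof -
    have x: "x \<in> space M" "pos x \<in> \<tau> (pos x + rem x)" using that by (auto simp: D_def)
    define h where "h = pos x + rem x"
    have "K \<le> h" using h_ge x by (simp add: h_def)
    then obtain l where l: "l \<in> (if full h (pos x) then {L} else {N, N + 1})" "pos x + l \<in> \<tau> h \<or> pos x + l = h"
      "\<forall>q. pos x < q \<and> q < pos x + l \<longrightarrow> q \<notin> \<tau> h" and \<tau>h: "\<forall>p\<in>\<tau> h. p < h"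
      using tiled[of h] x(2) unfolding tiled_def h_def by blast
    have DL: "x \<in> DL \<longleftrightarrow> full h (pos x)" using x by (simp add: DL_def h_def)
    have "pos x + l \<le> h" using l(2) \<tau>h by auto
    then have l_le: "l \<le> rem x" by (simp add: h_def)
    have inD: "(T ^^ i) x \<in> D \<longleftrightarrow> pos x + i \<in> \<tau> h" if "i < rem x" for i
      using pos_T[OF x(1) that] rem_T[OF x(1) that] that x by (simp add: D_def h_def)
    have "(T ^^ l) x \<in> D"
    proof (cases "pos x + l = h")
      case True
      then have "l = rem x" by (simp add: h_def)
      then show ?thesis using rem(2)[OF x(1)] A_D by simp
    next
      case False
      then have "l < rem x" using l_le by (auto simp: h_def)
      then show ?thesis using inD l(2) False by simp
    qed
    moreover have "(T ^^ i) x \<notin> D" if "0 < i \<and> i < l" for i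
      using inD[of i] l(3) l_le that by auto
    ultimately show ?thesis using l(1) unfolding DL L_def by blast
  qed
  have "DL \<subseteq> D" using full_in h_ge by (auto simp: DL_def D_def)
  have "A \<subseteq> D" using A_D by blast
  from base_switch[OF N \<open>D \<in> sets M\<close> \<open>DL \<in> sets M\<close> \<open>W \<in> sets M\<close> \<open>f \<in> borel_measurable M\<close> this \<open>DL \<subseteq> D\<close> step bnd]
  obtain B where B: "tower_base N B" "(\<integral>x. f x * indicator B x \<partial>M) =
    (\<integral>x. f x * indicator D x + (if x \<in> W then f ((T ^^ N) x) else f ((T ^^ (N + 1)) x)) * indicator DL x \<partial>M)"
    by blast
  note B(2)
  also have "(\<integral>x. f x * indicator D x + (if x \<in> W then f ((T ^^ N) x) else f ((T ^^ (N + 1)) x)) * indicator DL x \<partial>M) =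
     (\<integral>x. f x * indicator D x + m N x * indicator DL x \<partial>M)"
    by (intro Bochner_Integration.integral_cong) (auto simp: W_def m_def)
  finally have "(\<integral>x. f x * indicator B x \<partial>M) = (\<integral>x. f x * indicator D x + m N x * indicator DL x \<partial>M)" .
  moreover have "D \<subseteq> DL \<union> margin (N * N + (2 * N + 1))"
  proof
    fix x assume "x \<in> D"
    then show "x \<in> DL \<union> margin (N * N + (2 * N + 1))"
      using in_full[OF h_ge, of x "pos x"] by (auto simp: D_def DL_def margin_def L_def)
  qed
  moreover have "\<forall>x\<in>space M - margin (N * N + (2 * N + 1)). x \<in> DL \<longleftrightarrow> (pos x - N * N) mod (2 * N + 1) = j"
    by (auto simp: margin_def DL_def full_def L_def)
  ultimately show ?thesis using B(1) \<open>DL \<subseteq> D\<close> \<open>D \<in> sets M\<close> \<open>DL \<in> sets M\<close> by blast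
qed

lemma prob_margin:
  fixes K m :: nat
  assumes K: "0 < K" and gap: "\<And>x i. x \<in> A \<Longrightarrow> 0 < i \<Longrightarrow> i < K \<Longrightarrow> (T ^^ i) x \<notin> A"
  shows "prob (margin m) \<le> 2 * m / K"
proof -
  have "prob (margin m) \<le> prob ({x \<in> space M. pos x < m} \<union> {x \<in> space M. rem x < m})"
    by (intro finite_measure_mono) (auto simp: margin_def)
  also have "\<dots> \<le> prob {x \<in> space M. pos x < m} + prob {x \<in> space M. rem x < m}"
    by (intro measure_Un_le) auto
  also have "\<dots> \<le> 2 * m * prob A"
    using prob_pos_less[of m] prob_rem_less[of m] by simp
  also have "\<dots> \<le> 2 * m * (1 / K)"
    using prob_A_le[OF K gap] by (intro mult_left_mono) auto
  finally show ?thesis by simp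
qed

text \<open>The sum over all phases \<open>j\<close> is estimated, since away from the margin every point starts a full block for
  exactly one phase.\<close>

lemma base_negative_integral:
  fixes f :: "'a \<Rightarrow> real" and N K :: nat
  defines "(L :: nat) \<equiv> 2 * N + 1"
  assumes N: "0 < N" and K: "2 * (N * N) + L \<le> K"
    and gap: "\<And>x i. x \<in> A \<Longrightarrow> 0 < i \<Longrightarrow> i < K \<Longrightarrow> (T ^^ i) x \<notin> A"
    and [measurable]: "f \<in> borel_measurable M"
    and bnd: "\<And>x. x \<in> space M \<Longrightarrow> \<bar>f x\<bar> \<le> F" and mean: "(\<integral>x. f x \<partial>M) = 0"
    and small: "real (2 * L + 2) * F * (real (2 * (N * N + L)) / K) < (\<integral>x. \<bar>f x - f (T x)\<bar> \<partial>M) / 2"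
  shows "\<exists>B. tower_base N B \<and> (\<integral>x. f x * indicator B x \<partial>M) < 0"
proof -
  define m where "m x = min (f ((T ^^ N) x)) (f ((T ^^ (N + 1)) x))" for x
  let ?Y = "margin (N * N + L)"
  define good where "good j B D DL \<longleftrightarrow> tower_base N B \<and> D \<in> sets M \<and> DL \<in> sets M \<and>
    (\<integral>x. f x * indicator B x \<partial>M) = (\<integral>x. f x * indicator D x + m x * indicator DL x \<partial>M) \<and>
    DL \<subseteq> D \<and> D \<subseteq> DL \<union> ?Y \<and> (\<forall>x\<in>space M - ?Y. x \<in> DL \<longleftrightarrow> (pos x - N * N) mod L = j)" for j B D DL
  have "\<exists>B D DL. good j B D DL" if "j < L" for j
    using block_base_exists[OF N that[unfolded L_def] K[unfolded L_def] gap \<open>f \<in> borel_measurable M\<close> bnd]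
    unfolding good_def L_def m_def .
  then obtain B D DL where good: "\<And>j. j < L \<Longrightarrow> good j (B j) (D j) (DL j)"
    by metis
  have B: "tower_base N (B j)" and [measurable]: "D j \<in> sets M" "DL j \<in> sets M"
    and intB: "(\<integral>x. f x * indicator (B j) x \<partial>M) = (\<integral>x. f x * indicator (D j) x + m x * indicator (DL j) x \<partial>M)"
    and sub: "DL j \<subseteq> D j" "D j \<subseteq> DL j \<union> ?Y"
    and DL: "x \<in> space M - ?Y \<Longrightarrow> x \<in> DL j \<longleftrightarrow> (pos x - N * N) mod L = j"
    if "j < L" for j x
    using good[OF that] unfolding good_def by blast+
  have [measurable]: "?Y \<in> sets M" unfolding margin_def by measurable
  have [measurable]: "m \<in> borel_measurable M" unfolding m_def by measurable
  have F: "0 \<le> F" using bnd not_empty by (meson abs_ge_zero all_not_in_conv order_trans)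
  have mb: "\<bar>m x\<bar> \<le> F" if "x \<in> space M" for x
    using bnd[OF Tn_space[OF that], of N] bnd[OF Tn_space[OF that], of "N + 1"] unfolding m_def by linarith
  have int: "integrable M g" if "g \<in> borel_measurable M" "\<And>x. x \<in> space M \<Longrightarrow> \<bar>g x\<bar> \<le> c" for g :: "'a \<Rightarrow> real" and c
    using that by (intro integrable_const_bound[of _ c]) auto
  have term_le: "\<bar>f x * indicator (D j) x + m x * indicator (DL j) x\<bar> \<le> 2 * F" if "x \<in> space M" for x j
    using bnd[OF that] mb[OF that] F by (auto simp: indicator_def)
  \<comment> \<open>Off the margin exactly one phase contributes, with value
    \<open>f x + m x\<close>. On the margin the \<open>L\<close> terms are at most
    \<open>2 * F\<close> each, and a further \<open>2 * F\<close> compensates for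
    \<open>f x + m x\<close> on the right; this is the origin of \<open>2 * L + 2\<close>.\<close>
  have pointwise: "(\<Sum>j<L. f x * indicator (D j) x + m x * indicator (DL j) x) \<le> f x + m x + real (2 * L + 2) * F * indicator ?Y x"
    if x: "x \<in> space M" for x
  proof (cases "x \<in> ?Y")
    case True
    have "(\<Sum>j<L. f x * indicator (D j) x + m x * indicator (DL j) x) \<le> (\<Sum>j<L. 2 * F)"
      using term_le[OF x] by (intro sum_mono) (simp add: abs_le_iff)
    also have "\<dots> = 2 * L * F" by simp
    also have "\<dots> \<le> f x + m x + real (2 * L + 2) * F"
      using bnd[OF x] mb[OF x] by (simp add: algebra_simps abs_le_iff)
    finally show ?thesis using True by simp
  next
    case False
    let ?i = "(pos x - N * N) mod L"
    have "?i < L" by (simp add: L_def)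
    have "(\<Sum>j<L. f x * indicator (D j) x + m x * indicator (DL j) x) = (\<Sum>j<L. if ?i = j then f x + m x else 0)"
    proof (intro sum.cong refl)
      fix j assume "j \<in> {..<L}"
      then have "x \<in> D j \<longleftrightarrow> ?i = j" "x \<in> DL j \<longleftrightarrow> ?i = j"
        using DL[of j x] sub[of j] x False by auto
      then show "f x * indicator (D j) x + m x * indicator (DL j) x = (if ?i = j then f x + m x else 0)" by simp
    qed
    also have "\<dots> = f x + m x" using \<open>?i < L\<close> by simp
    finally show ?thesis using False by simp
  qed
  have "(\<Sum>j<L. \<integral>x. f x * indicator (B j) x \<partial>M) = (\<Sum>j<L. \<integral>x. f x * indicator (D j) x + m x * indicator (DL j) x \<partial>M)"
    using intB by simp
  also have "\<dots> = (\<integral>x. (\<Sum>j<L. f x * indicator (D j) x + m x * indicator (DL j) x) \<partial>M)"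
    using term_le by (intro Bochner_Integration.integral_sum[symmetric] int[of _ "2 * F"]) auto
  also have "\<dots> \<le> (\<integral>x. f x + m x + real (2 * L + 2) * F * indicator ?Y x \<partial>M)"
  proof (intro integral_mono pointwise)
    show "integrable M (\<lambda>x. \<Sum>j<L. f x * indicator (D j) x + m x * indicator (DL j) x)"
      using term_le by (intro Bochner_Integration.integrable_sum int[of _ "2 * F"]) auto
    show "integrable M (\<lambda>x. f x + m x + real (2 * L + 2) * F * indicator ?Y x)"
      using bnd mb
      by (intro Bochner_Integration.integrable_add integrable_mult_right int[of f F] int[of m F] int[of _ 1]) auto
  qed
  also have "\<dots> = (\<integral>x. m x \<partial>M) + real (2 * L + 2) * F * prob ?Y"
  proof -
    have "integrable M f" "integrable M m" using bnd mb by (auto intro: int[of _ F])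
    moreover have "integrable M (\<lambda>x. k * indicator ?Y x)" for k :: real
      by (intro integrable_mult_right int[of _ 1]) auto
    ultimately have "(\<integral>x. f x + m x + k * indicator ?Y x \<partial>M) = (\<integral>x. m x \<partial>M) + k * prob ?Y" for k :: real
      using mean \<open>?Y \<in> sets M\<close> by simp
    then show ?thesis .
  qed
  \<comment> \<open>Invariance under \<open>T^N\<close> reduces \<open>m\<close> to the minimum of
    \<open>f\<close> and \<open>f \<circ> T\<close>, that is, half their sum minus half their
    distance. The sum has integral zero, so the distance is the gain.\<close>
  also have "(\<integral>x. m x \<partial>M) = (\<integral>x. min (f x) (f (T x)) \<partial>M)"
    using integral_Tn[of "\<lambda>x. min (f x) (f (T x))" N] by (simp add: m_def)
  also have "\<dots> = (\<integral>x. (f x + f (T x) - \<bar>f x - f (T x)\<bar>) / 2 \<partial>M)"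
    by (intro Bochner_Integration.integral_cong) (auto simp: min_def)
  also have "\<dots> = - (\<integral>x. \<bar>f x - f (T x)\<bar> \<partial>M) / 2"
  proof -
    have fT: "\<bar>f (T x)\<bar> \<le> F" if "x \<in> space M" for x using bnd measurable_space[OF T_measurable that] .
    have "integrable M f" using bnd by (intro int) auto
    moreover have "integrable M (\<lambda>x. f (T x))" using fT by (intro int) auto
    moreover have "(\<integral>x. f (T x) \<partial>M) = 0" using integral_Tn[of f 1] mean by simp
    ultimately show ?thesis using mean by simp
  qed
  finally have "(\<Sum>j<L. \<integral>x. f x * indicator (B j) x \<partial>M) \<le>
      - (\<integral>x. \<bar>f x - f (T x)\<bar> \<partial>M) / 2 + real (2 * L + 2) * F * prob ?Y" .
  moreover have "real (2 * L + 2) * F * prob ?Y \<le> real (2 * L + 2) * F * (real (2 * (N * N + L)) / K)"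
    using prob_margin[of K "N * N + L", OF _ gap] K F by (intro mult_left_mono) (auto simp: L_def)
  ultimately have "(\<Sum>j<L. \<integral>x. f x * indicator (B j) x \<partial>M) < 0" using small by linarith
  \<comment> \<open>A negative sum over the phases has a negative term; that phase gives the
    base.\<close>
  then obtain j where "j < L" "(\<integral>x. f x * indicator (B j) x \<partial>M) < 0"
    by (meson lessThan_iff not_less sum_nonneg)
  then show ?thesis using B by blast
qed

section \<open>Independence by convexity and separation\<close>

text \<open>The vectors \<open>dev B\<close> measure the failure of independence, and a base with
  zero deviation is sought. A functional \<open>a\<close> evaluates on them as the integral over
  \<open>B\<close> of \<open>a \<circ> c\<close> minus its mean. Since \<open>C\<close> does not
  depend on \<open>a\<close>, the hypothesis \<open>small\<close> lets the same \<open>K\<close>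
  defeat every nonconstant functional.\<close>

lemma independent_base_exists:
  fixes c :: "'a \<Rightarrow> 'i" and N K :: nat and C :: real
  defines "(L :: nat) \<equiv> 2 * N + 1"
  assumes N: "0 < N" and K: "2 * (N * N) + L \<le> K"
    and gap: "\<And>x i. x \<in> A \<Longrightarrow> 0 < i \<Longrightarrow> i < K \<Longrightarrow> (T ^^ i) x \<notin> A"
    and H: "\<And>x. x \<in> space M \<Longrightarrow> pos x < H" and div: "divisible_measure M"
    and I: "finite I" and c[measurable]: "c \<in> measurable M (count_space I)"
    and C: "\<And>x a. x \<in> space M \<Longrightarrow> \<bar>a (c x) - (\<integral>y. a (c y) \<partial>M)\<bar> \<le> C * (\<integral>y. \<bar>a (c y) - a (c (T y))\<bar> \<partial>M)"
    and small: "real (2 * L + 2) * C * (real (2 * (N * N + L)) / K) < 1 / 2"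
  shows "\<exists>B. tower_base N B \<and> (\<forall>i\<in>I. prob (B \<inter> {x \<in> space M. c x = i}) = prob B * prob {x \<in> space M. c x = i})"
proof -
  define cell where "cell i = {x \<in> space M. c x = i}" for i
  define dev where "dev B i = prob (B \<inter> cell i) - prob B * prob (cell i)" for B i
  have cell[measurable]: "cell i \<in> sets M" for i
    unfolding cell_def by (rule sets_level_set[OF c])
  have cI: "c x \<in> I" if "x \<in> space M" for x using measurable_space[OF c that] by simp
  have ac[measurable]: "(\<lambda>x. a (c x)) \<in> borel_measurable M" for a :: "'i \<Rightarrow> real"
    by (rule measurable_compose[OF c]) simp
  have expand: "(\<integral>x. a (c x) * indicator B x \<partial>M) = (\<Sum>i\<in>I. a i * prob (B \<inter> cell i))"
    if [measurable]: "B \<in> sets M" for B and a :: "'i \<Rightarrow> real"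
  proof -
    have "(\<integral>x. a (c x) * indicator B x \<partial>M) = (\<integral>x. (\<Sum>i\<in>I. a i * indicator (B \<inter> cell i) x) \<partial>M)"
    proof (intro Bochner_Integration.integral_cong refl)
      fix x assume x: "x \<in> space M"
      have "(\<Sum>i\<in>I. a i * indicator (B \<inter> cell i) x) = (\<Sum>i\<in>I. if i = c x then a (c x) * indicator B x else 0)"
        using x by (intro sum.cong) (auto simp: cell_def indicator_def)
      then show "a (c x) * indicator B x = (\<Sum>i\<in>I. a i * indicator (B \<inter> cell i) x)"
        using cI[OF x] I by simp
    qed
    also have "\<dots> = (\<Sum>i\<in>I. (\<integral>x. a i * indicator (B \<inter> cell i) x \<partial>M))"
      using that cell
      by (intro Bochner_Integration.integral_sum integrable_mult_right integrable_real_indicator)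
         (auto simp: less_top[symmetric])
    finally show ?thesis by simp
  qed
  \<comment> \<open>Centering \<open>a \<circ> c\<close> accounts for the product term
    \<open>prob B * prob (cell i)\<close> in the deviation.\<close>
  have dev_sum: "(\<Sum>i\<in>I. a i * dev B i) = (\<integral>x. (a (c x) - (\<integral>y. a (c y) \<partial>M)) * indicator B x \<partial>M)"
    if B[measurable]: "B \<in> sets M" for B and a :: "'i \<Rightarrow> real"
  proof -
    let ?m = "\<integral>y. a (c y) \<partial>M"
    have "?m = (\<integral>x. a (c x) * indicator (space M) x \<partial>M)"
      by (intro Bochner_Integration.integral_cong) auto
    also have "\<dots> = (\<Sum>i\<in>I. a i * prob (cell i))"
      using expand[of "space M" a] by (simp add: cell_def Int_def conj_left_commute)
    finally have m: "?m = (\<Sum>i\<in>I. a i * prob (cell i))" .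
    have "\<bar>a (c x)\<bar> \<le> (\<Sum>i\<in>I. \<bar>a i\<bar>)" if "x \<in> space M" for x
      using cI[OF that] I by (intro member_le_sum[of "c x" I "\<lambda>i. \<bar>a i\<bar>"]) auto
    then have "\<bar>a (c x) * indicator B x\<bar> \<le> (\<Sum>i\<in>I. \<bar>a i\<bar>)" if "x \<in> space M" for x
      using that by (auto simp: indicator_def sum_nonneg)
    then have int: "integrable M (\<lambda>x. a (c x) * indicator B x)"
      by (intro integrable_const_bound[of _ "\<Sum>i\<in>I. \<bar>a i\<bar>"]) auto
    have "(\<integral>x. (a (c x) - ?m) * indicator B x \<partial>M) = (\<integral>x. a (c x) * indicator B x - ?m * indicator B x \<partial>M)"
      by (simp add: left_diff_distrib)
    also have "\<dots> = (\<integral>x. a (c x) * indicator B x \<partial>M) - (\<integral>x. ?m * indicator B x \<partial>M)"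
      using int B
      by (intro Bochner_Integration.integral_diff integrable_mult_right integrable_real_indicator)
         (auto simp: less_top[symmetric])
    also have "(\<integral>x. ?m * indicator B x \<partial>M) = ?m * prob B"
      using sets.sets_into_space[OF B] by (simp add: Int_absorb2)
    also have "(\<integral>x. a (c x) * indicator B x \<partial>M) - ?m * prob B = (\<Sum>i\<in>I. a i * dev B i)"
      unfolding expand[OF B] m sum_distrib_right sum_subtractf[symmetric]
      by (intro sum.cong) (simp_all add: dev_def algebra_simps)
    finally show ?thesis by simp
  qed
  define V where "V = dev ` {B. tower_base N B}"
  have "\<exists>v\<in>V. \<forall>i\<in>I. v i = 0"
  proof (rule convex_set_contains_zero[OF I])
    show "V \<noteq> {}"
    proof -
      \<comment> \<open>With the zero function and phase \<open>0\<close>, the block construction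
        simply supplies some base.\<close>
      have "\<exists>B. tower_base N B"
        using block_base_exists[of N 0 K "\<lambda>_. 0" 0] N K gap by (auto simp: L_def)
      then show ?thesis by (auto simp: V_def)
    qed
  next
    fix u v and t :: real assume "u \<in> V" "v \<in> V" and t: "0 \<le> t" "t \<le> 1"
    then obtain B0 B1 where B: "tower_base N B0" "tower_base N B1" "u = dev B0" "v = dev B1" by (auto simp: V_def)
    then have [measurable]: "B0 \<in> sets M" "B1 \<in> sets M" by (auto simp: tower_base_def)
    \<comment> \<open>Besides the traces on the cells, \<open>B0\<close> and \<open>B1\<close>
      themselves are included, so that \<open>prob B\<close> is affine in \<open>t\<close> as well;
      then so is \<open>dev B\<close>, as \<open>prob (cell i)\<close> is constant.\<close>
    let ?\<R> = "{B0, B1} \<union> (\<lambda>i. B0 \<inter> cell i) ` I \<union> (\<lambda>i. B1 \<inter> cell i) ` I"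
    have "finite ?\<R>" "?\<R> \<subseteq> sets M" using I by auto
    from column_set_exists[OF H div this t] obtain Q where Q: "column_set Q" "\<And>R. R \<in> ?\<R> \<Longrightarrow> prob (R \<inter> Q) = t * prob R"
      by blast
    have [measurable]: "Q \<in> sets M" using Q by (simp add: column_set_def)
    define B where "B = (B1 \<inter> Q) \<union> (B0 - Q)"
    have "tower_base N B" unfolding B_def using base_mix B(1,2) Q(1) by blast
    have mix: "prob (B \<inter> E) = (1 - t) * prob (B0 \<inter> E) + t * prob (B1 \<inter> E)"
      if [measurable]: "E \<in> sets M" and R: "B0 \<inter> E \<in> ?\<R>" "B1 \<inter> E \<in> ?\<R>" for E
    proof -
      have "prob (B \<inter> E) = prob ((B1 \<inter> E) \<inter> Q) + prob ((B0 \<inter> E) - (B0 \<inter> E) \<inter> Q)"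
        unfolding B_def by (subst finite_measure_Union[symmetric]) (auto intro!: arg_cong[where f = prob])
      also have "prob ((B0 \<inter> E) - (B0 \<inter> E) \<inter> Q) = prob (B0 \<inter> E) - prob ((B0 \<inter> E) \<inter> Q)"
        by (intro finite_measure_Diff) auto
      finally show ?thesis using Q(2)[OF R(1)] Q(2)[OF R(2)] by (simp add: algebra_simps)
    qed
    have sp: "B0 \<inter> space M = B0" "B1 \<inter> space M = B1" "B \<inter> space M = B"
      using \<open>B0 \<in> sets M\<close> \<open>B1 \<in> sets M\<close> sets.sets_into_space by (auto simp: B_def)
    have mixB: "prob B = (1 - t) * prob B0 + t * prob B1"
      using mix[of "space M"] sp by simp
    have mixc: "prob (B \<inter> cell i) = (1 - t) * prob (B0 \<inter> cell i) + t * prob (B1 \<inter> cell i)" for i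
    proof (cases "i \<in> I")
      case True
      then show ?thesis by (intro mix) auto
    next
      case False
      then have "cell i = {}" using cI by (auto simp: cell_def)
      then show ?thesis by simp
    qed
    have "(\<lambda>i. (1 - t) * u i + t * v i) = dev B"
      unfolding B(3,4) dev_def mixB mixc by (auto simp: algebra_simps)
    then show "(\<lambda>i. (1 - t) * u i + t * v i) \<in> V" using \<open>tower_base N B\<close> by (auto simp: V_def)
  next
    fix a :: "'i \<Rightarrow> real" and v
    assume nn: "\<And>v. v \<in> V \<Longrightarrow> 0 \<le> (\<Sum>i\<in>I. a i * v i)" and "v \<in> V"
    define f where "f x = a (c x) - (\<integral>y. a (c y) \<partial>M)" for x
    define G where "G = (\<integral>x. \<bar>f x - f (T x)\<bar> \<partial>M)"
    have G': "G = (\<integral>y. \<bar>a (c y) - a (c (T y))\<bar> \<partial>M)" by (simp add: G_def f_def)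
    have f[measurable]: "f \<in> borel_measurable M" unfolding f_def by measurable
    have fb: "\<bar>f x\<bar> \<le> C * G" if "x \<in> space M" for x
      using C[OF that, of a] by (simp add: G' f_def)
    have mean: "(\<integral>x. f x \<partial>M) = 0"
      using dev_sum[of "space M" a] sets.sets_into_space[OF cell] prob_space
      by (simp add: f_def dev_def Int_absorb1 cong: Bochner_Integration.integral_cong)
    obtain B where B: "tower_base N B" "v = dev B" using \<open>v \<in> V\<close> by (auto simp: V_def)
    \<comment> \<open>Multiplying \<open>small\<close> by \<open>G > 0\<close> gives exactly the
      smallness condition for \<open>F = C * G\<close>, and a base with negative integral
      contradicts the sign of the functional. Once \<open>G = 0\<close>, the bound
      \<open>C * G\<close> forces \<open>f\<close> to vanish.\<close>
    have "G = 0"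
    proof (rule ccontr)
      assume "G \<noteq> 0"
      moreover have "0 \<le> G" unfolding G_def by simp
      ultimately have "0 < G" by simp
      have "real (2 * L + 2) * C * (real (2 * (N * N + L)) / K) * G < 1 / 2 * G"
        using small \<open>0 < G\<close> by (rule mult_strict_right_mono)
      then have sm: "real (2 * L + 2) * (C * G) * (real (2 * (N * N + L)) / K) < G / 2"
        by (simp add: ac_simps)
      obtain B where "tower_base N B" "(\<integral>x. f x * indicator B x \<partial>M) < 0"
        using base_negative_integral[OF N K[unfolded L_def] gap f fb[unfolded G_def] mean sm[unfolded L_def G_def]] by blast
      then have "(\<Sum>i\<in>I. a i * dev B i) < 0" "dev B \<in> V"
        using dev_sum[of B a] by (auto simp: tower_base_def f_def V_def)
      then show False using nn by force
    qed
    then have "f x = 0" if "x \<in> space M" for x using fb[OF that] by simp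
    then have "(\<integral>x. f x * indicator B x \<partial>M) = (\<integral>x. 0 \<partial>M)"
      by (intro Bochner_Integration.integral_cong) auto
    then show "(\<Sum>i\<in>I. a i * v i) = 0"
      using dev_sum[of B a] B by (simp add: tower_base_def f_def)
  qed
  then show ?thesis by (auto simp: V_def dev_def cell_def)
qed


section \<open>Subdividing columns to bound the return times\<close>

lemma pos_rem_S:
  assumes x: "x \<in> space M" and k: "k \<le> pos x"
  shows "pos ((S ^^ k) x) = pos x - k" "rem ((S ^^ k) x) = rem x + k"
proof -
  let ?y = "(S ^^ pos x) x"
  have y: "?y \<in> space M" "pos ?y = 0" "rem ?y = pos x + rem x"
    using x S_pos[OF x] by (auto simp: pos_eq_0 rem_S_pos)
  have eq: "(S ^^ k) x = (T ^^ (pos x - k)) ?y" using TS_le[OF x, of "pos x - k" "pos x"] k by simp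
  have lt: "pos x - k < rem ?y" using rem(1)[OF x] y by simp
  show "pos ((S ^^ k) x) = pos x - k" "rem ((S ^^ k) x) = rem x + k"
    unfolding eq pos_T[OF y(1) lt] rem_T[OF y(1) lt] using y k by auto
qed

text \<open>Each column is cut at the levels divisible by \<open>K\<close>, except that a cut with
  fewer than \<open>K\<close> levels above it is omitted. The resulting pieces have lengths from
  \<open>K\<close> to \<open>2 * K - 1\<close>.\<close>

lemma bounded_return_set_exists:
  assumes K: "0 < K" and gap: "\<And>x i. x \<in> A \<Longrightarrow> 0 < i \<Longrightarrow> i < K \<Longrightarrow> (T ^^ i) x \<notin> A"
  shows "\<exists>A'\<in>sets M. (\<forall>x\<in>A'. \<forall>i. 0 < i \<and> i < K \<longrightarrow> (T ^^ i) x \<notin> A') \<and>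
           (\<forall>x\<in>space M. \<exists>n<2 * K. (S ^^ n) x \<in> A')"
proof (intro bexI conjI ballI allI impI)
  let ?A = "{x \<in> space M. pos x mod K = 0 \<and> K \<le> rem x}"
  show "?A \<in> sets M" by measurable
  show "(T ^^ i) x \<notin> ?A" if "x \<in> ?A" "0 < i \<and> i < K" for x i
  proof -
    have "pos ((T ^^ i) x) = pos x + i" using that pos_T[of x i] by auto
    then have "pos ((T ^^ i) x) mod K = i" using that by (metis (mono_tags, lifting) mem_Collect_eq mod_add_left_eq mod_less add_0)
    then show ?thesis using that by simp
  qed
  show "\<exists>n<2 * K. (S ^^ n) x \<in> ?A" if x: "x \<in> space M" for x
  proof -
    define k where "k = pos x mod K"
    have k: "k < K" "k \<le> pos x" "(pos x - k) mod K = 0" using K by (auto simp: k_def minus_mod_eq_mult_div)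
    \<comment> \<open>Either the nearest cut below \<open>x\<close> is kept, or it was omitted and
      the preceding cut is used, or the column has height below \<open>K\<close>, which the gap
      condition excludes.\<close>
    consider "K \<le> rem x + k" | "rem x + k < K" "K + k \<le> pos x" | "rem x + k < K" "pos x < K + k" by linarith
    then show ?thesis
    proof cases
      case 1
      then show ?thesis using k x pos_rem_S[OF x k(2)] by (intro exI[of _ k]) auto
    next
      case 2
      then have "(pos x - (K + k)) mod K = 0"
        using k(3) le_mod_geq[of K "pos x - k"] 2 by (simp add: add.commute)
      then show ?thesis using k(1) x 2 pos_rem_S[OF x 2(2)] by (intro exI[of _ "K + k"]) auto
    next
      case 3
      then have "pos x - k < K" using k(1) by linarith
      then have "pos x = k" using k by simp
      moreover have "K \<le> pos x + rem x" by (rule height_ge[OF _ x]) (rule gap)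
      ultimately show ?thesis using 3 by simp
    qed
  qed
qed

end

text \<open>The hypotheses on \<open>A\<close> give no upper bound for the return times, so
  \<open>A\<close> is first replaced by \<open>A'\<close>. The resulting base is then unfolded into
  levels that are disjoint and cover the space with no exceptional points.\<close>

lemma (in mp_system) independent_strict_tower_exists:
  fixes c :: "'a \<Rightarrow> 'i" and N K :: nat and C :: real
  defines "(L :: nat) \<equiv> 2 * N + 1"
  assumes N: "0 < N" and K: "2 * (N * N) + L \<le> K"
    and A: "A \<in> sets M" "\<And>x i. x \<in> A \<Longrightarrow> 0 < i \<Longrightarrow> i < K \<Longrightarrow> (T ^^ i) x \<notin> A"
      "\<And>x. x \<in> space M \<Longrightarrow> \<exists>n. (S ^^ n) x \<in> A" "\<And>x. x \<in> space M \<Longrightarrow> \<exists>n. (T ^^ n) x \<in> A"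
    and div: "divisible_measure M"
    and I: "finite I" and c: "c \<in> measurable M (count_space I)"
    and C: "\<And>x a. x \<in> space M \<Longrightarrow> \<bar>a (c x) - (\<integral>y. a (c y) \<partial>M)\<bar> \<le> C * (\<integral>y. \<bar>a (c y) - a (c (T y))\<bar> \<partial>M)"
    and small: "real (2 * L + 2) * C * (real (2 * (N * N + L)) / K) < 1 / 2"
  shows "\<exists>B\<in>sets M. \<exists>E\<in>sets M. (\<forall>i. (T ^^ i) ` B \<in> sets M) \<and>
    (\<forall>i j. i < j \<and> j < N \<longrightarrow> (T ^^ i) ` B \<inter> (T ^^ j) ` B = {}) \<and> (\<forall>i<N. (T ^^ i) ` B \<inter> E = {}) \<and>
    space M = (\<Union>i<N. (T ^^ i) ` B) \<union> E \<and> T ` E \<subseteq> B \<and>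
    (\<forall>i\<in>I. prob (B \<inter> {x \<in> space M. c x = i}) = prob B * prob {x \<in> space M. c x = i})"
proof -
  interpret R0: return_system M T S A
    by unfold_locales (use A in auto)
  have "0 < K" using K by (simp add: L_def)
  have "\<exists>A'\<in>sets M. (\<forall>x\<in>A'. \<forall>i. 0 < i \<and> i < K \<longrightarrow> (T ^^ i) x \<notin> A') \<and>
           (\<forall>x\<in>space M. \<exists>n<2 * K. (S ^^ n) x \<in> A')"
    by (rule R0.bounded_return_set_exists[OF \<open>0 < K\<close>]) (rule A(2))
  then obtain A' where A': "A' \<in> sets M" "\<forall>x\<in>A'. \<forall>i. 0 < i \<and> i < K \<longrightarrow> (T ^^ i) x \<notin> A'"
    "\<forall>x\<in>space M. \<exists>n<2 * K. (S ^^ n) x \<in> A'"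
    by (elim bexE conjE)
  have gap': "(T ^^ i) x \<notin> A'" if "x \<in> A'" "0 < i" "i < K" for x i using A'(2) that by blast
  interpret R: return_system M T S A'
  proof unfold_locales
    fix x assume x: "x \<in> space M"
    show "\<exists>n. (S ^^ n) x \<in> A'" using A'(3) x by blast
    \<comment> \<open>A visit fewer than \<open>2 * K\<close> steps before
      \<open>(T ^^ (2 * K)) x\<close> lies in the future of \<open>x\<close>.\<close>
    obtain n where "n < 2 * K" "(S ^^ n) ((T ^^ (2 * K)) x) \<in> A'" using A'(3) Tn_space[OF x] by blast
    then show "\<exists>n. (T ^^ n) x \<in> A'" using ST_le[OF x, of n "2 * K"] by auto
  qed (rule A')
  have H: "R.pos x < 2 * K" if "x \<in> space M" for x
    using A'(3) R.pos_le[of _ x] that by (meson le_less_trans)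
  obtain B where B: "R.tower_base N B" and indep: "\<forall>i\<in>I. prob (B \<inter> {x \<in> space M. c x = i}) = prob B * prob {x \<in> space M. c x = i}"
    using R.independent_base_exists[OF N K[unfolded L_def] gap' H div I c C small[unfolded L_def]] by blast
  have Bs[measurable]: "B \<in> sets M" using B by (simp add: R.tower_base_def)
  have sp: "x \<in> space M" if "x \<in> B" for x using that sets.sets_into_space[OF Bs] by blast
  \<comment> \<open>\<open>E\<close> collects the level \<open>N\<close> of those base points that
    do not return after \<open>N\<close> steps; they return after \<open>N + 1\<close>, hence
    \<open>T\<close> maps \<open>E\<close> into \<open>B\<close>.\<close>
  define E where "E = {x \<in> space M. (S ^^ N) x \<in> B \<and> x \<notin> B}"
  have img: "(T ^^ i) ` B = {x \<in> space M. (S ^^ i) x \<in> B}" for i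
  proof (intro equalityI subsetI)
    fix x assume "x \<in> {x \<in> space M. (S ^^ i) x \<in> B}"
    then show "x \<in> (T ^^ i) ` B" by (intro image_eqI[of _ _ "(S ^^ i) x"]) auto
  qed (use sp in auto)
  have gap: "(T ^^ i) x \<notin> B" if "x \<in> B" "0 < i" "i < N" for x i
    using B that by (auto simp: R.tower_base_def)
  have disj: "(S ^^ i) x \<notin> B" if "x \<in> space M" "i < j" "j \<le> N" "j - i < N" "(S ^^ j) x \<in> B" for i j x
    using gap[of "(S ^^ j) x" "j - i"] TS_le[of x "j - i" j] that by auto
  have E: "E \<in> sets M" unfolding E_def by measurable
  have levels: "(T ^^ i) ` B \<in> sets M" for i unfolding img by measurable
  have disj_levels: "(T ^^ i) ` B \<inter> (T ^^ j) ` B = {}" if "i < j \<and> j < N" for i j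
    unfolding img using disj[of _ i j] that by auto
  have disj_E: "(T ^^ i) ` B \<inter> E = {}" if "i < N" for i
    unfolding img E_def using disj[of _ i N] that by (cases "i = 0") auto
  have cover: "space M = (\<Union>i<N. (T ^^ i) ` B) \<union> E"
  proof (intro equalityI subsetI)
    fix x assume x: "x \<in> space M"
    obtain i where i: "i \<le> N" "(S ^^ i) x \<in> B" using R.base_past[OF B N x] by blast
    show "x \<in> (\<Union>i<N. (T ^^ i) ` B) \<union> E"
    proof (cases "i < N")
      case True
      then show ?thesis unfolding img using i x by auto
    next
      case False
      then show ?thesis unfolding img E_def using i x N by (cases "x \<in> B") (auto intro!: bexI[of _ 0])
    qed
  qed (auto simp: img E_def)
  have TE: "T ` E \<subseteq> B"
  proof (intro image_subsetI)
    fix x assume "x \<in> E"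
    then have x: "x \<in> space M" "(S ^^ N) x \<in> B" "x \<notin> B" by (auto simp: E_def)
    then have "(T ^^ N) ((S ^^ N) x) \<in> B \<or> (T ^^ (N + 1)) ((S ^^ N) x) \<in> B"
      using B unfolding R.tower_base_def by blast
    then show "T x \<in> B" using x by simp
  qed
  show ?thesis
    using Bs E levels disj_levels disj_E cover TE indep by blast
qed

section \<open>Ergodicity\<close>

locale ergodic_system = prob_space M for M :: "'a measure" +
  fixes T :: "'a \<Rightarrow> 'a"
  assumes T_meas[measurable]: "T \<in> measurable M M"
    and T_distr: "distr M M T = M"
    and erg: "ergodic M T"
begin

lemma iterate_measurable[measurable]: "T ^^ n \<in> measurable M M"
  by (rule measurable_funpow) measurable

lemma AE_T: assumes "AE x in M. P x" shows "AE x in M. P (T x)"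
proof -
  have "AE x in distr M M T. P x" using assms unfolding T_distr .
  then show ?thesis by (rule AE_distrD[OF T_meas])
qed

lemma AE_iterate: assumes "AE x in M. P x" shows "AE x in M. P ((T ^^ n) x)"
proof (induction n)
  case 0
  then show ?case using assms by simp
next
  case (Suc n)
  then show ?case using AE_T[OF Suc] by (simp add: funpow_swap1)
qed

lemma prob_preimage: assumes "C \<in> sets M" shows "prob {x \<in> space M. T x \<in> C} = prob C"
  using measure_distr[OF T_meas assms] by (simp add: T_distr vimage_def Int_def conj_commute)

lemma prob_iterate: "C \<in> sets M \<Longrightarrow> prob {x \<in> space M. (T ^^ n) x \<in> C} = prob C"
proof (induction n)
  case 0
  then show ?case using sets.sets_into_space[of C M] by (auto intro!: arg_cong[where f = prob])
next
  case (Suc n)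
  have "{x \<in> space M. (T ^^ Suc n) x \<in> C} = {x \<in> space M. T x \<in> {x \<in> space M. (T ^^ n) x \<in> C}}"
    using measurable_space[OF T_meas] by (auto simp: funpow_swap1)
  moreover have "{x \<in> space M. (T ^^ n) x \<in> C} \<in> sets M" using Suc.prems by measurable
  ultimately show ?case using prob_preimage Suc by (simp only:)
qed

text \<open>Up to a null set \<open>Y\<close> is contained in its preimage under \<open>T\<close>,
  which has the same measure; so forward invariance is already invariance almost everywhere.\<close>

lemma forward_invariant_trivial:
  assumes Y[measurable]: "Y \<in> sets M" and inv: "AE x in M. x \<in> Y \<longrightarrow> T x \<in> Y"
  shows "prob Y = 0 \<or> prob Y = 1"
proof -
  let ?Z = "{x \<in> space M. T x \<in> Y}"
  have "prob (?Z \<inter> Y) = prob Y"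
    by (rule measure_eq_AE) (use inv in auto)
  then have "prob (?Z - Y) = 0"
    using finite_measure_Diff'[of ?Z Y] prob_preimage[OF Y] by simp
  then have "AE x in M. x \<notin> ?Z - Y"
    by (simp add: prob_eq_0)
  then have "AE x in M. T x \<in> Y \<longleftrightarrow> x \<in> Y" using inv AE_space by eventually_elim auto
  then have "AE x in M. \<forall>n. T ((T ^^ n) x) \<in> Y \<longleftrightarrow> (T ^^ n) x \<in> Y"
    unfolding AE_all_countable by (intro allI AE_iterate)
  then have AE_const: "AE x in M. \<forall>n. (T ^^ n) x \<in> Y \<longleftrightarrow> x \<in> Y"
  proof eventually_elim
    case (elim x)
    have "(T ^^ n) x \<in> Y \<longleftrightarrow> x \<in> Y" for n using elim by (induction n) auto
    then show ?case by blast
  qed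
  \<comment> \<open>\<open>ergodic\<close> only speaks about strictly invariant sets, so \<open>Y\<close> is replaced by its limit inferior.\<close>
  define Y' where "Y' = {x \<in> space M. \<exists>n. \<forall>m\<ge>n. (T ^^ m) x \<in> Y}"
  have [measurable]: "Y' \<in> sets M" unfolding Y'_def by measurable
  have "T -` Y' \<inter> space M = Y'"
  proof (intro equalityI subsetI)
    fix x assume "x \<in> T -` Y' \<inter> space M"
    then obtain n where x: "x \<in> space M" and n: "\<forall>m\<ge>n. (T ^^ m) (T x) \<in> Y" by (auto simp: Y'_def)
    have "(T ^^ m) x \<in> Y" if "m \<ge> Suc n" for m
      using n[rule_format, of "m - 1"] that by (cases m) (auto simp: funpow_swap1)
    then show "x \<in> Y'" using x by (auto simp: Y'_def)
  next
    fix x assume "x \<in> Y'"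
    then obtain n where x: "x \<in> space M" and n: "\<forall>m\<ge>n. (T ^^ m) x \<in> Y" by (auto simp: Y'_def)
    have "(T ^^ m) (T x) \<in> Y" if "m \<ge> n" for m
      using n[rule_format, of "Suc m"] that by (auto simp: funpow_swap1)
    then show "x \<in> T -` Y' \<inter> space M" using x measurable_space[OF T_meas] by (auto simp: Y'_def)
  qed
  then have "Y' \<in> null_sets M \<or> space M - Y' \<in> null_sets M"
    using erg by (auto simp: ergodic_def)
  then have "prob Y' = 0 \<or> prob Y' = 1"
    using prob_compl[of Y'] by (auto simp: null_sets_def measure_def)
  moreover have "prob Y' = prob Y"
  proof (rule measure_eq_AE)
    show "AE x in M. x \<in> Y' \<longleftrightarrow> x \<in> Y"
      using AE_const AE_space by eventually_elim (auto simp: Y'_def)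
  qed auto
  ultimately show ?thesis by simp
qed

text \<open>\<open>A\<close> keeps those visits to a set \<open>A0\<close> that are followed by
  \<open>K - 1\<close> steps outside it. If \<open>A\<close> were null, almost every visit would be
  followed by another within fewer than \<open>K\<close> steps, and the points visiting
  \<open>A0\<close> within \<open>K\<close> steps would form a forward invariant set
  \<open>Y\<close>. Its measure lies between \<open>1 / (K + 1)\<close> and
  \<open>K / (K + 1)\<close>, which ergodicity forbids.\<close>

lemma separated_set_exists:
  assumes div: "divisible_measure M" and K: "0 < K"
  shows "\<exists>A\<in>sets M. 0 < prob A \<and> (\<forall>x\<in>A. \<forall>i. 0 < i \<and> i < K \<longrightarrow> (T ^^ i) x \<notin> A)"
proof -
  have "0 \<le> 1 / real (K + 1)" "1 / real (K + 1) \<le> prob (space M)" by (auto simp: prob_space)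
  then obtain A0 where A0[measurable]: "A0 \<in> sets M" and pA0: "prob A0 = 1 / real (K + 1)"
    using div sets.top unfolding divisible_measure_def by blast
  define A where "A = {x \<in> space M. x \<in> A0 \<and> (\<forall>i\<in>{0<..<K}. (T ^^ i) x \<notin> A0)}"
  have A[measurable]: "A \<in> sets M" unfolding A_def by measurable
  have "0 < prob A"
  proof (rule ccontr)
    assume "\<not> 0 < prob A"
    then have "prob A = 0" using measure_nonneg[of M A] by linarith
    then have AE_A: "AE x in M. x \<notin> A" by (simp add: prob_eq_0)
    define Y where "Y = {x \<in> space M. \<exists>i\<in>{..<K}. (T ^^ i) x \<in> A0}"
    have Y[measurable]: "Y \<in> sets M" unfolding Y_def by measurable
    have "AE x in M. x \<in> Y \<longrightarrow> T x \<in> Y"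
      using AE_A
    proof eventually_elim
      case (elim x)
      show ?case
      proof
        assume "x \<in> Y"
        then obtain i where i: "x \<in> space M" "i < K" "(T ^^ i) x \<in> A0" by (auto simp: Y_def)
        obtain j where "j < K" "(T ^^ Suc j) x \<in> A0"
        proof (cases i)
          case 0
          then obtain k where "0 < k" "k < K" "(T ^^ k) x \<in> A0" using elim i by (auto simp: A_def)
          then show ?thesis using that[of "k - 1"] by (cases k) auto
        next
          case (Suc j)
          then show ?thesis using that[of j] i by auto
        qed
        then show "T x \<in> Y" using i measurable_space[OF T_meas] by (auto simp: Y_def funpow_swap1)
      qed
    qed
    then have "prob Y = 0 \<or> prob Y = 1" by (rule forward_invariant_trivial[OF Y])
    moreover have "prob A0 \<le> prob Y"
      using K sets.sets_into_space[OF A0] by (intro finite_measure_mono) (auto simp: Y_def intro!: bexI[of _ 0])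
    moreover have "prob Y \<le> (\<Sum>i<K. prob {x \<in> space M. (T ^^ i) x \<in> A0})"
    proof -
      have "Y = (\<Union>i<K. {x \<in> space M. (T ^^ i) x \<in> A0})" by (auto simp: Y_def)
      then show ?thesis by (auto intro!: finite_measure_subadditive_finite)
    qed
    moreover have "(\<Sum>i<K. prob {x \<in> space M. (T ^^ i) x \<in> A0}) = K / real (K + 1)"
      using prob_iterate[OF A0] pA0 by simp
    moreover have "K / real (K + 1) < 1" "0 < 1 / real (K + 1)" by (auto simp: field_simps)
    ultimately show False using pA0 by linarith
  qed
  then show ?thesis using A by (intro bexI[of _ A]) (auto simp: A_def)
qed

text \<open>The points that never visit \<open>A\<close> form a forward invariant set disjoint from
  \<open>A\<close>, hence not of full measure.\<close>

lemma AE_visits: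
  assumes A[measurable]: "A \<in> sets M" and pos: "0 < prob A"
  shows "AE x in M. \<exists>n. (T ^^ n) x \<in> A"
proof -
  define Z where "Z = {x \<in> space M. \<forall>n. (T ^^ n) x \<notin> A}"
  have Z[measurable]: "Z \<in> sets M" unfolding Z_def by measurable
  have "x \<in> Z \<longrightarrow> T x \<in> Z" for x
  proof
    assume "x \<in> Z"
    then have x: "x \<in> space M" "\<forall>n. (T ^^ n) x \<notin> A" by (auto simp: Z_def)
    have "(T ^^ n) (T x) \<notin> A" for n
      using x(2)[rule_format, of "Suc n"] by (simp add: funpow_swap1)
    then show "T x \<in> Z" using x(1) measurable_space[OF T_meas] by (auto simp: Z_def)
  qed
  then have "prob Z = 0 \<or> prob Z = 1" by (intro forward_invariant_trivial) auto
  moreover have "prob Z + prob A \<le> 1"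
  proof -
    have "Z \<inter> A = {}" by (auto simp: Z_def dest: spec[of _ 0])
    then have "prob Z + prob A = prob (Z \<union> A)" by (simp add: finite_measure_Union)
    then show ?thesis by simp
  qed
  ultimately have "prob Z = 0" using pos by linarith
  then have "AE x in M. x \<notin> Z" by (simp add: prob_eq_0)
  then show ?thesis using AE_space by eventually_elim (auto simp: Z_def)
qed

text \<open>Having visited \<open>A\<close> in the past persists under \<open>T\<close>, so
  ergodicity of \<open>T\<close> yields a statement about the iterates of \<open>S\<close>.\<close>

lemma AE_visits_inverse:
  assumes S[measurable]: "S \<in> measurable M M" and ST: "AE x in M. S (T x) = x"
    and A[measurable]: "A \<in> sets M" and pos: "0 < prob A"
  shows "AE x in M. \<exists>n. (S ^^ n) x \<in> A"
proof -
  have [measurable]: "S ^^ n \<in> measurable M M" for n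
    by (rule measurable_funpow) measurable
  define Z where "Z = {x \<in> space M. \<exists>n. (S ^^ n) x \<in> A}"
  have Z[measurable]: "Z \<in> sets M" unfolding Z_def by measurable
  have "AE x in M. x \<in> Z \<longrightarrow> T x \<in> Z"
    using ST
  proof eventually_elim
    case (elim x)
    show ?case
    proof
      assume "x \<in> Z"
      then obtain n where "x \<in> space M" "(S ^^ n) x \<in> A" by (auto simp: Z_def)
      then have "T x \<in> space M" "(S ^^ Suc n) (T x) \<in> A"
        using elim measurable_space[OF T_meas] by (auto simp: funpow_swap1)
      then show "T x \<in> Z" unfolding Z_def by blast
    qed
  qed
  then have "prob Z = 0 \<or> prob Z = 1" by (rule forward_invariant_trivial[OF Z])
  moreover have "prob A \<le> prob Z"
    using sets.sets_into_space[OF A] by (intro finite_measure_mono) (auto simp: Z_def intro!: exI[of _ 0])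
  ultimately have "prob Z = 1" using pos by linarith
  then have "AE x in M. x \<in> Z" by (simp add: prob_eq_1)
  then show ?thesis by eventually_elim (auto simp: Z_def)
qed

text \<open>
  The cells \<open>i\<close> for which \<open>\<bar>a i - a i0\<bar>\<close> is controlled uniformly in \<open>a\<close> are closed under transitions
  \<open>i \<rightarrow> j\<close> of positive probability, so by ergodicity they carry full measure.
\<close>

lemma deviation_bound:
  fixes c :: "'a \<Rightarrow> 'i"
  assumes I: "finite I" and c[measurable]: "c \<in> measurable M (count_space I)"
  shows "\<exists>C::real. 0 \<le> C \<and> (AE x in M. \<forall>a. \<bar>a (c x) - (\<integral>y. a (c y) \<partial>M)\<bar> \<le> C * (\<integral>y. \<bar>a (c y) - a (c (T y))\<bar> \<partial>M))"
proof -
  define cell where "cell i = {x \<in> space M. c x = i}" for i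
  have cell: "cell i \<in> sets M" for i
    unfolding cell_def by (rule sets_level_set[OF c])
  have cI: "c x \<in> I" if "x \<in> space M" for x using measurable_space[OF c that] by simp
  have cT: "(\<lambda>x. c (T x)) \<in> measurable M (count_space I)" by measurable
  define G where "G a = (\<integral>y. \<bar>a (c y) - a (c (T y))\<bar> \<partial>M)" for a :: "'i \<Rightarrow> real"
  have G: "0 \<le> G a" for a unfolding G_def by simp
  have ac[measurable]: "(\<lambda>x. a (c x)) \<in> borel_measurable M" "(\<lambda>x. a (c (T x))) \<in> borel_measurable M"
    for a :: "'i \<Rightarrow> real"
    by (rule measurable_compose[OF c], simp) (rule measurable_compose[OF cT], simp)
  have ab: "\<bar>a i\<bar> \<le> (\<Sum>i\<in>I. \<bar>a i\<bar>)" if "i \<in> I" for a :: "'i \<Rightarrow> real" and i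
    using that I by (intro member_le_sum[of i I "\<lambda>i. \<bar>a i\<bar>"]) auto
  have int: "integrable M (\<lambda>x. a (c x))" for a :: "'i \<Rightarrow> real"
    using ab cI by (intro integrable_const_bound[of _ "\<Sum>i\<in>I. \<bar>a i\<bar>"]) auto
  have intG: "integrable M (\<lambda>y. \<bar>a (c y) - a (c (T y))\<bar>)" for a :: "'i \<Rightarrow> real"
  proof -
    have "integrable M (\<lambda>x. a (c (T x)))"
      using ab cI measurable_space[OF T_meas] by (intro integrable_const_bound[of _ "\<Sum>i\<in>I. \<bar>a i\<bar>"]) auto
    then show ?thesis using int by (intro integrable_abs Bochner_Integration.integrable_diff)
  qed
  have "\<exists>i\<in>I. 0 < prob (cell i)"
  proof (rule ccontr)
    assume "\<not> (\<exists>i\<in>I. 0 < prob (cell i))"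
    then have "\<forall>i\<in>I. prob (cell i) = 0" using measure_nonneg[of M] by (metis less_eq_real_def)
    then have "prob (\<Union>i\<in>I. cell i) \<le> 0"
      using finite_measure_subadditive_finite[OF I, of cell] cell by (auto simp: image_subset_iff)
    moreover have "(\<Union>i\<in>I. cell i) = space M" using cI by (auto simp: cell_def)
    ultimately show False using prob_space by simp
  qed
  then obtain i0 where i0: "i0 \<in> I" "0 < prob (cell i0)" by blast
  define R where "R = {i \<in> I. \<exists>C. \<forall>a. \<bar>a i - a i0\<bar> \<le> C * G a}"
  define U where "U = {x \<in> space M. c x \<in> R}"
  have U: "U \<in> sets M"
  proof -
    have "U = c -` (R \<inter> I) \<inter> space M" using cI by (auto simp: U_def)
    moreover have "c -` (R \<inter> I) \<inter> space M \<in> sets M" by (rule measurable_sets[OF c]) simp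
    ultimately show ?thesis by simp
  qed
  \<comment> \<open>A transition from \<open>i\<close> to \<open>j\<close> of probability
    \<open>q > 0\<close> gives \<open>\<bar>a i - a j\<bar> * q \<le> G a\<close>, so a constant
    \<open>C\<close> for \<open>i\<close> yields the constant \<open>C + 1 / q\<close> for
    \<open>j\<close>, uniformly in \<open>a\<close>.\<close>
  have null: "AE x in M. \<not> (c x = i \<and> c (T x) = j)" if i: "i \<in> R" and j: "j \<in> I - R" for i j
  proof (rule ccontr)
    assume nAE: "\<not> (AE x in M. \<not> (c x = i \<and> c (T x) = j))"
    let ?F = "cell i \<inter> {x \<in> space M. T x \<in> cell j}"
    have F: "?F \<in> sets M" using cell by measurable
    have "\<not> prob ?F = 0"
    proof
      assume "prob ?F = 0"
      then have "AE x in M. x \<notin> ?F" using F by (simp add: prob_eq_0)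
      then have "AE x in M. \<not> (c x = i \<and> c (T x) = j)"
        using AE_space by eventually_elim (use measurable_space[OF T_meas] in \<open>auto simp: cell_def\<close>)
      then show False using nAE by contradiction
    qed
    then have q: "0 < prob ?F" using measure_nonneg[of M ?F] by linarith
    obtain C where C: "\<And>a. \<bar>a i - a i0\<bar> \<le> C * G a" using i by (auto simp: R_def)
    have "\<bar>a j - a i0\<bar> \<le> (C + 1 / prob ?F) * G a" for a
    proof -
      have "(\<integral>x. \<bar>a i - a j\<bar> * indicator ?F x \<partial>M) \<le> G a"
        unfolding G_def
      proof (rule integral_mono[OF _ intG])
        show "integrable M (\<lambda>x. \<bar>a i - a j\<bar> * indicator ?F x)"
          using F by (intro integrable_mult_right integrable_real_indicator) (auto simp: less_top[symmetric])
      qed (auto simp: cell_def indicator_def)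
      then have "\<bar>a i - a j\<bar> * prob ?F \<le> G a" using F by simp
      then have "\<bar>a i - a j\<bar> \<le> G a / prob ?F" using q by (simp add: field_simps)
      then show ?thesis using C[of a] by (simp add: distrib_right)
    qed
    then show False using j by (auto simp: R_def)
  qed
  have "AE x in M. \<forall>i\<in>R. \<forall>j\<in>I - R. \<not> (c x = i \<and> c (T x) = j)"
    using null I by (intro AE_finite_allI) (auto simp: R_def)
  then have "AE x in M. x \<in> U \<longrightarrow> T x \<in> U"
    using AE_space by eventually_elim (use measurable_space[OF T_meas] cI in \<open>auto simp: U_def\<close>)
  then have "prob U = 0 \<or> prob U = 1" by (rule forward_invariant_trivial[OF U])
  moreover have "prob (cell i0) \<le> prob U"
    using i0 U by (intro finite_measure_mono) (auto simp: cell_def U_def R_def intro: exI[of _ 0])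
  ultimately have "prob U = 1" using i0 by linarith
  then have AE_U: "AE x in M. c x \<in> R" using U AE_space by (auto simp: prob_eq_1 U_def)
  have "\<forall>i\<in>R. \<exists>C. \<forall>a. \<bar>a i - a i0\<bar> \<le> C * G a" by (auto simp: R_def)
  then obtain C where C: "\<And>i a. i \<in> R \<Longrightarrow> \<bar>a i - a i0\<bar> \<le> C i * G a" by metis
  have "finite R" using I by (simp add: R_def)
  define D where "D = (\<Sum>i\<in>R. \<bar>C i\<bar>)"
  have D: "\<bar>a i - a i0\<bar> \<le> D * G a" if "i \<in> R" for i a
  proof -
    have "C i \<le> D" using member_le_sum[OF that, of "\<lambda>i. \<bar>C i\<bar>"] \<open>finite R\<close> by (auto simp: D_def)
    then have "C i * G a \<le> D * G a" using G by (rule mult_right_mono)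
    then show ?thesis using C[OF that, of a] by linarith
  qed
  have mean: "\<bar>(\<integral>y. a (c y) \<partial>M) - a i0\<bar> \<le> D * G a" for a
  proof -
    have "(\<integral>y. a (c y) \<partial>M) - a i0 = (\<integral>y. a (c y) - a i0 \<partial>M)"
      using int by (simp add: prob_space)
    also have "\<bar>\<dots>\<bar> \<le> (\<integral>y. \<bar>a (c y) - a i0\<bar> \<partial>M)" by (rule integral_abs_bound)
    also have "\<dots> \<le> (\<integral>y. D * G a \<partial>M)"
    proof (rule integral_mono_AE)
      show "integrable M (\<lambda>y. \<bar>a (c y) - a i0\<bar>)" using int by simp
      show "AE y in M. \<bar>a (c y) - a i0\<bar> \<le> D * G a"
        using AE_U by eventually_elim (rule D)
    qed simp
    finally show ?thesis by (simp add: prob_space)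
  qed
  \<comment> \<open>Both \<open>a (c x)\<close> and the mean are within \<open>D * G a\<close> of
    the reference value \<open>a i0\<close>, whence the factor \<open>2\<close>.\<close>
  have "AE x in M. \<forall>a. \<bar>a (c x) - (\<integral>y. a (c y) \<partial>M)\<bar> \<le> (2 * D) * G a"
    using AE_U
  proof eventually_elim
    case (elim x)
    show ?case
    proof
      fix a
      show "\<bar>a (c x) - (\<integral>y. a (c y) \<partial>M)\<bar> \<le> (2 * D) * G a"
        using D[OF elim, of a] mean[of a] by linarith
    qed
  qed
  moreover have "0 \<le> 2 * D" by (simp add: D_def sum_nonneg)
  ultimately have "0 \<le> 2 * D \<and> (AE x in M. \<forall>a. \<bar>a (c x) - (\<integral>y. a (c y) \<partial>M)\<bar> \<le> (2 * D) * G a)"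
    by (rule conjI[rotated])
  then show ?thesis unfolding G_def by (rule exI)
qed

end

section \<open>From Lebesgue spaces to invertible systems\<close>

text \<open>The isomorphism \<open>f\<close> onto a part of the unit interval sweeps out
  \<open>C\<close>: the measure of the part of \<open>C\<close> with \<open>f \<le> t\<close> grows
  by at most the length of the interval of parameters. It is therefore continuous in
  \<open>t\<close>, and the intermediate value theorem yields every value \<open>r\<close>.\<close>

lemma lebesgue_prob_space_divisible:
  assumes "lebesgue_prob_space M"
  shows "divisible_measure M"
  unfolding divisible_measure_def
proof (intro ballI allI impI, elim conjE)
  fix C r assume C: "C \<in> sets M" and r: "0 \<le> r" "r \<le> measure M C"
  interpret prob_space M using assms by (simp add: lebesgue_prob_space_def)
  let ?\<nu> = "completion M"
  let ?L = "lebesgue_on {0..1::real}"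
  obtain X0 Y0 f where X0: "X0 \<in> sets ?\<nu>" and Y0: "Y0 \<in> sets ?L"
    and nX0: "space ?\<nu> - X0 \<in> null_sets ?\<nu>"
    and f: "f \<in> measurable (restrict_space ?\<nu> X0) (restrict_space ?L Y0)"
    and dist: "distr (restrict_space ?\<nu> X0) (restrict_space ?L Y0) f = restrict_space ?L Y0"
    using assms unfolding lebesgue_prob_space_def iso_mod_null_def by blast
  interpret \<nu>: prob_space "completion M" by (rule prob_space_completion)
  have C\<nu>: "C \<in> sets ?\<nu>" using C by (rule sets_completionI_sets)
  have X0sp: "X0 \<subseteq> space ?\<nu>" using sets.sets_into_space[OF X0] .
  have Y0sp: "Y0 \<subseteq> {0..1}" using sets.sets_into_space[OF Y0] by simp
  have Y0leb: "Y0 \<in> sets lebesgue" using Y0 by (simp add: sets_restrict_space_iff)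
  have pre: "{x \<in> X0. f x \<in> J} \<in> sets ?\<nu>" "measure ?\<nu> {x \<in> X0. f x \<in> J} = measure lebesgue (Y0 \<inter> J)"
    if J: "J \<in> sets lebesgue" for J
  proof -
    have B: "Y0 \<inter> J \<in> sets (restrict_space ?L Y0)"
    proof -
      have "Y0 \<inter> J \<in> sets ?L"
        using sets.Int[OF Y0leb J] Y0sp by (subst sets_restrict_space_iff) auto
      then show ?thesis
        using Y0 Y0sp by (subst sets_restrict_space_iff) (auto simp: Int_absorb2)
    qed
    have eq: "f -` (Y0 \<inter> J) \<inter> space (restrict_space ?\<nu> X0) = {x \<in> X0. f x \<in> J}"
      using measurable_space[OF f] X0sp Y0sp by (auto simp: space_restrict_space)
    have "f -` (Y0 \<inter> J) \<inter> space (restrict_space ?\<nu> X0) \<in> sets (restrict_space ?\<nu> X0)"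
      by (rule measurable_sets[OF f B])
    then show 1: "{x \<in> X0. f x \<in> J} \<in> sets ?\<nu>"
      unfolding eq using sets_restrict_space_iff[of X0 ?\<nu>] X0 X0sp by (auto simp: Int_absorb2)
    have "measure ?\<nu> {x \<in> X0. f x \<in> J} = measure (restrict_space ?\<nu> X0) {x \<in> X0. f x \<in> J}"
      using X0 X0sp by (intro measure_restrict_space[symmetric]) auto
    also have "\<dots> = measure (distr (restrict_space ?\<nu> X0) (restrict_space ?L Y0) f) (Y0 \<inter> J)"
      using measure_distr[OF f B] eq by simp
    also have "\<dots> = measure ?L (Y0 \<inter> J)"
      unfolding dist using Y0 Y0sp by (intro measure_restrict_space) auto
    also have "\<dots> = measure lebesgue (Y0 \<inter> J)"
      using Y0sp by (intro measure_restrict_space) auto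
    finally show "measure ?\<nu> {x \<in> X0. f x \<in> J} = measure lebesgue (Y0 \<inter> J)" .
  qed
  have pre_le: "measure ?\<nu> {x \<in> X0. f x \<in> J} \<le> measure lebesgue J" if "J \<in> lmeasurable" for J
    unfolding pre(2)[OF fmeasurableD[OF that]]
    using that Y0leb by (intro measure_mono_fmeasurable) auto
  define g where "g t = measure ?\<nu> ({x \<in> X0. f x \<in> {..t}} \<inter> C)" for t
  have slice: "{x \<in> X0. f x \<in> {..t}} \<inter> C \<in> sets ?\<nu>" for t
    using pre(1)[of "{..t}"] C\<nu> by auto
  have step: "g s \<le> g t \<and> g t - g s \<le> t - s" if "s \<le> t" for s t
  proof -
    have sub: "{x \<in> X0. f x \<in> {..s}} \<inter> C \<subseteq> {x \<in> X0. f x \<in> {..t}} \<inter> C" using that by auto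
    have "g t - g s = measure ?\<nu> (({x \<in> X0. f x \<in> {..t}} \<inter> C) - ({x \<in> X0. f x \<in> {..s}} \<inter> C))"
      unfolding g_def using \<nu>.finite_measure_Diff[OF slice slice sub] by simp
    also have "\<dots> \<le> measure ?\<nu> {x \<in> X0. f x \<in> {s<..t}}"
      using pre(1)[of "{s<..t}"] by (intro \<nu>.finite_measure_mono) auto
    also have "\<dots> \<le> measure lebesgue {s<..t}"
      by (intro pre_le bounded_set_imp_lmeasurable) auto
    also have "\<dots> = t - s" using that by simp
    finally show ?thesis unfolding g_def using \<nu>.finite_measure_mono[OF sub slice] by simp
  qed
  have "continuous_on {0..1} g"
  proof (rule lipschitz_on_continuous_on[of 1], rule lipschitz_onI)
    fix s t :: real
    show "dist (g s) (g t) \<le> 1 * dist s t"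
      using step[of s t] step[of t s] by (cases "s \<le> t") (auto simp: dist_real_def)
  qed simp
  moreover have "g 0 \<le> r"
  proof -
    have "g 0 \<le> measure ?\<nu> {x \<in> X0. f x \<in> {..0}}"
      unfolding g_def using pre(1)[of "{..0}"] by (intro \<nu>.finite_measure_mono) auto
    also have "\<dots> = measure lebesgue (Y0 \<inter> {..0})" using pre(2)[of "{..0}"] by simp
    also have "Y0 \<inter> {..0} = Y0 \<inter> {0}" using Y0sp by auto
    also have "measure lebesgue (Y0 \<inter> {0}) = measure ?\<nu> {x \<in> X0. f x \<in> {0}}" using pre(2)[of "{0}"] by simp
    also have "\<dots> \<le> measure lebesgue {0::real}" by (intro pre_le bounded_set_imp_lmeasurable) auto
    finally show ?thesis using r(1) by simp
  qed
  moreover have "r \<le> g 1"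
  proof -
    have "{x \<in> X0. f x \<in> {..1}} = X0"
      using measurable_space[OF f] X0sp Y0sp by (auto simp: space_restrict_space)
    then have g1: "g 1 = measure ?\<nu> (X0 \<inter> C)" by (simp add: g_def)
    have "AE x in ?\<nu>. x \<in> X0" using nX0 by (rule AE_I') auto
    then have "measure ?\<nu> (X0 \<inter> C) = measure ?\<nu> C"
      using X0 C\<nu> by (intro measure_eq_AE) auto
    then show ?thesis using g1 r(2) C by simp
  qed
  ultimately obtain t where t: "g t = r" using IVT'[of g 0 r 1] by auto
  let ?D = "{x \<in> X0. f x \<in> {..t}} \<inter> C"
  \<comment> \<open>The slice is measurable only for the completion; its main part lies in
    \<open>sets M\<close> and has the same measure.\<close>
  have "main_part M ?D \<subseteq> C" using main_part_null_part_Un[OF slice[of t]] by blast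
  moreover have "measure M (main_part M ?D) = r"
    using t emeasure_completion[OF slice[of t]] unfolding g_def measure_def by simp
  ultimately show "\<exists>D\<in>sets M. D \<subseteq> C \<and> measure M D = r"
    using main_part_sets[OF slice[of t]] by blast
qed

section \<open>Passing to an invariant set of full measure\<close>

lemma (in prob_space) restrict_space_full:
  assumes X: "X \<in> sets M" and full: "AE x in M. x \<in> X"
  shows "prob_space (restrict_space M X)"
    and "\<And>C. C \<in> sets (restrict_space M X) \<longleftrightarrow> C \<in> sets M \<and> C \<subseteq> X"
    and "\<And>C. C \<subseteq> X \<Longrightarrow> measure (restrict_space M X) C = prob C"
    and "\<And>g :: 'a \<Rightarrow> real. g \<in> borel_measurable M \<Longrightarrow> (\<integral>x. g x \<partial>restrict_space M X) = (\<integral>x. g x \<partial>M)"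
    and "divisible_measure M \<Longrightarrow> divisible_measure (restrict_space M X)"
    and "space (restrict_space M X) = X"
proof -
  have Xsp: "X \<inter> space M = X" using sets.sets_into_space[OF X] by blast
  show "prob_space (restrict_space M X)"
    using X full by (intro prob_space_restrict_space emeasure_eq_1_AE) auto
  show sets: "C \<in> sets (restrict_space M X) \<longleftrightarrow> C \<in> sets M \<and> C \<subseteq> X" for C
    using X Xsp by (auto simp: sets_restrict_space_iff)
  show meas: "measure (restrict_space M X) C = prob C" if "C \<subseteq> X" for C
    using that X Xsp by (intro measure_restrict_space) auto
  show "(\<integral>x. g x \<partial>restrict_space M X) = (\<integral>x. g x \<partial>M)" if [measurable]: "g \<in> borel_measurable M" for g :: "'a \<Rightarrow> real"
  proof -
    note X[measurable]
    have "(\<integral>x. g x \<partial>restrict_space M X) = (\<integral>x. indicator X x *\<^sub>R g x \<partial>M)"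
      using X Xsp by (intro integral_restrict_space) auto
    also have "\<dots> = (\<integral>x. g x \<partial>M)"
    proof (rule integral_cong_AE)
      show "AE x in M. indicator X x *\<^sub>R g x = g x" using full by eventually_elim simp
    qed measurable
    finally show ?thesis .
  qed
  show "divisible_measure (restrict_space M X)" if div: "divisible_measure M"
    unfolding divisible_measure_def
  proof (intro ballI allI impI)
    fix C r assume C: "C \<in> sets (restrict_space M X)" and r: "0 \<le> r \<and> r \<le> measure (restrict_space M X) C"
    then have "C \<in> sets M" "C \<subseteq> X" "0 \<le> r \<and> r \<le> prob C" using sets meas by auto
    then obtain D where "D \<in> sets M" "D \<subseteq> C" "prob D = r" using div unfolding divisible_measure_def by blast
    then show "\<exists>D\<in>sets (restrict_space M X). D \<subseteq> C \<and> measure (restrict_space M X) D = r"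
      using sets meas \<open>C \<subseteq> X\<close> by (intro bexI[of _ D]) auto
  qed
  show "space (restrict_space M X) = X" using Xsp by (simp add: space_restrict_space)
qed

text \<open>Discard every point from which some iterate of \<open>T\<close> or \<open>S\<close>
  meets the null set where \<open>P\<close> or one of the inverse identities fails. The parameter
  \<open>P\<close> allows further almost sure properties to be made pointwise at the same
  time.\<close>

lemma (in ergodic_system) mp_system_restriction:
  assumes S[measurable]: "S \<in> measurable M M" and ST: "AE x in M. S (T x) = x" and TS: "AE x in M. T (S x) = x"
    and P: "AE x in M. P x"
  shows "\<exists>X\<in>sets M. (AE x in M. x \<in> X) \<and> (\<forall>x\<in>X. P x) \<and> mp_system (restrict_space M X) T S"
proof -
  \<comment> \<open>Needed so that conditions on the iterates of \<open>S\<close> also fail only on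
    null sets. It follows from the invariance under \<open>T\<close> because \<open>S\<close>
    inverts \<open>T\<close> almost everywhere.\<close>
  have distr_S: "distr M M S = M"
  proof (rule measure_eqI)
    fix C assume "C \<in> sets (distr M M S)"
    then have [measurable]: "C \<in> sets M" by simp
    have "emeasure (distr M M S) C = emeasure M (S -` C \<inter> space M)"
      by (intro emeasure_distr) auto
    also have "\<dots> = emeasure (distr M M T) (S -` C \<inter> space M)" by (simp only: T_distr)
    also have "\<dots> = emeasure M (T -` (S -` C \<inter> space M) \<inter> space M)"
      by (intro emeasure_distr) auto
    also have "\<dots> = emeasure M C"
    proof (rule emeasure_eq_AE)
      show "AE x in M. x \<in> T -` (S -` C \<inter> space M) \<inter> space M \<longleftrightarrow> x \<in> C"
        using ST AE_space by eventually_elim (use measurable_space[OF T_meas] in auto)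
    qed auto
    finally show "emeasure (distr M M S) C = emeasure M C" .
  qed simp
  have Sn[measurable]: "S ^^ n \<in> measurable M M" for n
    by (rule measurable_funpow) measurable
  have AE_S: "AE x in M. Q ((S ^^ n) x)" if "AE x in M. Q x" for Q n
  proof (induction n)
    case 0
    then show ?case using that by simp
  next
    case (Suc n)
    have "AE x in distr M M S. Q ((S ^^ n) x)" using Suc unfolding distr_S .
    from AE_distrD[OF S this] show ?case by (simp add: funpow_swap1)
  qed
  have "AE x in M. P x \<and> S (T x) = x \<and> T (S x) = x" using P ST TS by eventually_elim simp
  then obtain Nl where Nl: "{x \<in> space M. \<not> (P x \<and> S (T x) = x \<and> T (S x) = x)} \<subseteq> Nl" "Nl \<in> null_sets M"
    unfolding eventually_ae_filter by blast
  define X where "X = {x \<in> space M. \<forall>n. (T ^^ n) x \<notin> Nl \<and> (S ^^ n) x \<notin> Nl}"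
  have [measurable]: "Nl \<in> sets M" using Nl(2) by auto
  have X[measurable]: "X \<in> sets M" unfolding X_def by measurable
  have "AE x in M. x \<notin> Nl" using Nl(2) by (rule AE_not_in)
  then have "AE x in M. \<forall>n. (T ^^ n) x \<notin> Nl \<and> (S ^^ n) x \<notin> Nl"
    unfolding AE_all_countable AE_conj_iff using AE_iterate[of "\<lambda>x. x \<notin> Nl"] AE_S[of "\<lambda>x. x \<notin> Nl"] by blast
  then have full: "AE x in M. x \<in> X" using AE_space by eventually_elim (simp add: X_def)
  have PX: "P x" "S (T x) = x" "T (S x) = x" if "x \<in> X" for x
  proof -
    have "x \<in> space M" "x \<notin> Nl" using that by (auto simp: X_def dest: spec[of _ 0])
    then show "P x" "S (T x) = x" "T (S x) = x" using Nl(1) by auto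
  qed
  have TX: "T x \<in> X" if "x \<in> X" for x
  proof -
    have "(T ^^ n) (T x) \<notin> Nl" for n
      using that by (auto simp: X_def funpow_swap1 dest: spec[of _ "Suc n"])
    moreover have "(S ^^ n) (T x) \<notin> Nl" for n
    proof (cases n)
      case 0
      have "(T ^^ Suc 0) x \<notin> Nl" using that unfolding X_def by blast
      then show ?thesis using 0 by simp
    next
      case (Suc m)
      then have "(S ^^ n) (T x) = (S ^^ m) x" using PX(2)[OF that] by (simp add: funpow_swap1)
      then show ?thesis using that by (auto simp: X_def)
    qed
    ultimately show ?thesis using that measurable_space[OF T_meas] by (auto simp: X_def)
  qed
  have SX: "S x \<in> X" if "x \<in> X" for x
  proof -
    have "(S ^^ n) (S x) \<notin> Nl" for n
      using that by (auto simp: X_def funpow_swap1 dest: spec[of _ "Suc n"])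
    moreover have "(T ^^ n) (S x) \<notin> Nl" for n
    proof (cases n)
      case 0
      have "(S ^^ Suc 0) x \<notin> Nl" using that unfolding X_def by blast
      then show ?thesis using 0 by simp
    next
      case (Suc m)
      then have "(T ^^ n) (S x) = (T ^^ m) x" using PX(3)[OF that] by (simp add: funpow_swap1)
      then show ?thesis using that by (auto simp: X_def)
    qed
    ultimately show ?thesis using that measurable_space[OF S] by (auto simp: X_def)
  qed
  note R = restrict_space_full[OF X full]
  interpret R: prob_space "restrict_space M X" by (rule R(1))
  have T': "T \<in> measurable (restrict_space M X) (restrict_space M X)"
    using TX by (intro measurable_restrict_space3) auto
  have "mp_system (restrict_space M X) T S"
  proof unfold_locales
    show "S \<in> measurable (restrict_space M X) (restrict_space M X)"
      using SX by (intro measurable_restrict_space3) auto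
    show "distr (restrict_space M X) (restrict_space M X) T = restrict_space M X"
    proof (rule measure_eqI)
      fix C assume "C \<in> sets (distr (restrict_space M X) (restrict_space M X) T)"
      then have C: "C \<in> sets (restrict_space M X)" by simp
      then have [measurable]: "C \<in> sets M" and CX: "C \<subseteq> X" using R(2) by auto
      have "measure (distr (restrict_space M X) (restrict_space M X) T) C =
          measure (restrict_space M X) (T -` C \<inter> X)"
        using measure_distr[OF T' C] R(6) by simp
      also have "\<dots> = prob (T -` C \<inter> X)" by (rule R(3)) auto
      also have "\<dots> = prob {x \<in> space M. T x \<in> C}"
      proof (rule measure_eq_AE)
        show "AE x in M. x \<in> T -` C \<inter> X \<longleftrightarrow> x \<in> {x \<in> space M. T x \<in> C}"
          using full AE_space by eventually_elim auto
        have "T -` C \<inter> X = {x \<in> space M. T x \<in> C \<and> x \<in> X}" by (auto simp: X_def)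
        then show "T -` C \<inter> X \<in> sets M" by simp
      qed measurable
      also have "\<dots> = prob C" by (rule prob_preimage) measurable
      also have "\<dots> = measure (restrict_space M X) C" by (rule R(3)[OF CX, symmetric])
      finally show "emeasure (distr (restrict_space M X) (restrict_space M X) T) C = emeasure (restrict_space M X) C"
        using prob_space.prob_space_distr[OF R(1) T'] R.emeasure_eq_measure
        by (simp add: finite_measure.emeasure_eq_measure prob_space_def)
    qed simp
  qed (use T' PX R(6) in auto)
  then show ?thesis using X full PX(1) by blast
qed

section \<open>Choice of constants and return to the given space\<close>

theorem theorem1:
  fixes M :: "'a measure" and T :: "'a \<Rightarrow> 'a" and \<P> :: "'a set set" and N :: nat
  assumes "lebesgue_prob_space M"
    and "finite \<P>" and "partition_mod_null M \<P> (\<lambda>P. P)"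
    and "invertible_mpt M T" and "ergodic M T"
    and "N \<ge> 1"
  shows "\<exists>B\<in>sets M. \<exists>E\<in>sets M. alpern_tower M T N B E \<and>
           (\<forall>P\<in>\<P>. measure M (B \<inter> P) = measure M B * measure M P)"
proof -
  interpret prob_space M using assms(1) by (simp add: lebesgue_prob_space_def)
  interpret ergodic_system M T
    by unfold_locales (use assms(4,5) in \<open>auto simp: invertible_mpt_def\<close>)
  have div: "divisible_measure M" using assms(1) by (rule lebesgue_prob_space_divisible)
  obtain S where S: "S \<in> measurable M M" "AE x in M. S (T x) = x" "AE x in M. T (S x) = x"
    using assms(4) by (auto simp: invertible_mpt_def)
  have \<P>: "P \<in> sets M" if "P \<in> \<P>" for P using assms(3) that by (auto simp: partition_mod_null_def)
  \<comment> \<open>With the set of all cells containing \<open>x\<close> as label, null overlaps of the cells need no special treatment.\<close>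
  define c where "c x = {P \<in> \<P>. x \<in> P}" for x
  have cellM: "{x \<in> space M. c x = v} \<in> sets M" if "v \<in> Pow \<P>" for v
  proof -
    have "{x \<in> space M. c x = v} = {x \<in> space M. \<forall>P\<in>\<P>. x \<in> P \<longleftrightarrow> P \<in> v}"
      using that by (auto simp: c_def)
    then show ?thesis using sets_membership_pattern[OF assms(2)] \<P> by (simp add: subset_iff)
  qed
  have c: "c \<in> measurable M (count_space (Pow \<P>))"
    unfolding measurable_count_space_eq2[OF finite_Pow_iff[THEN iffD2, OF assms(2)]]
  proof (intro conjI ballI)
    show "c \<in> space M \<rightarrow> Pow \<P>" by (auto simp: c_def)
    fix v assume "v \<in> Pow \<P>"
    moreover have "c -` {v} \<inter> space M = {x \<in> space M. c x = v}" by auto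
    ultimately show "c -` {v} \<inter> space M \<in> sets M" using cellM by simp
  qed
  obtain C :: real where C: "0 \<le> C" and AE_C: "AE x in M. \<forall>a. \<bar>a (c x) - (\<integral>y. a (c y) \<partial>M)\<bar> \<le> C * (\<integral>y. \<bar>a (c y) - a (c (T y))\<bar> \<partial>M)"
    using deviation_bound[OF finite_Pow_iff[THEN iffD2, OF assms(2)] c] by blast
  define L where "L = 2 * N + 1"
  \<comment> \<open>The smallness condition reads \<open>D / K < 1 / 2\<close>. The summand
    \<open>2 * (N * N) + L\<close> in \<open>K\<close> is the least height for which the block
    tilings are available.\<close>
  define D where "D = real (2 * L + 2) * C * real (2 * (N * N + L))"
  obtain K0 :: nat where K0: "2 * D < K0" using reals_Archimedean2 by blast
  define K where "K = K0 + (2 * (N * N) + L)"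
  have "real K0 \<le> real K" unfolding of_nat_le_iff by (simp add: K_def)
  then have "2 * D < K" using K0 by linarith
  have "0 < K" by (simp add: K_def L_def)
  then have small: "real (2 * L + 2) * C * (real (2 * (N * N + L)) / K) < 1 / 2"
    using \<open>2 * D < K\<close> by (simp add: D_def field_simps)
  obtain A where A: "A \<in> sets M" "0 < prob A" "\<forall>x\<in>A. \<forall>i. 0 < i \<and> i < K \<longrightarrow> (T ^^ i) x \<notin> A"
    using separated_set_exists[OF div \<open>0 < K\<close>] by blast
  define good where "good x \<longleftrightarrow> (\<exists>n. (T ^^ n) x \<in> A) \<and> (\<exists>n. (S ^^ n) x \<in> A) \<and>
    (\<forall>a. \<bar>a (c x) - (\<integral>y. a (c y) \<partial>M)\<bar> \<le> C * (\<integral>y. \<bar>a (c y) - a (c (T y))\<bar> \<partial>M))" for x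
  have "AE x in M. good x"
    using AE_visits[OF A(1,2)] AE_visits_inverse[OF S(1,2) A(1,2)] AE_C
    by eventually_elim (simp add: good_def)
  from mp_system_restriction[OF S this]
  obtain X where X: "X \<in> sets M" and full: "AE x in M. x \<in> X" and good: "\<forall>x\<in>X. good x"
    and mp: "mp_system (restrict_space M X) T S" by blast
  let ?R = "restrict_space M X"
  note R = restrict_space_full[OF X full]
  interpret R: mp_system ?R T S by (rule mp)
  have TnX: "(T ^^ n) x \<in> X" "(S ^^ n) x \<in> X" if "x \<in> X" for n x
    using R.Tn_space[of x n] R.Sn_space[of x n] that by (simp_all add: R(6))
  obtain B E where B: "B \<in> sets ?R" "E \<in> sets ?R" and levels: "\<forall>i. (T ^^ i) ` B \<in> sets ?R"
    and disj: "\<forall>i j. i < j \<and> j < N \<longrightarrow> (T ^^ i) ` B \<inter> (T ^^ j) ` B = {}" "\<forall>i<N. (T ^^ i) ` B \<inter> E = {}"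
    and cover: "space ?R = (\<Union>i<N. (T ^^ i) ` B) \<union> E" and TE: "T ` E \<subseteq> B"
    and indep: "\<forall>v\<in>Pow \<P>. measure ?R (B \<inter> {x \<in> space ?R. c x = v}) = measure ?R B * measure ?R {x \<in> space ?R. c x = v}"
  proof -
    have "\<exists>B\<in>sets ?R. \<exists>E\<in>sets ?R. (\<forall>i. (T ^^ i) ` B \<in> sets ?R) \<and>
      (\<forall>i j. i < j \<and> j < N \<longrightarrow> (T ^^ i) ` B \<inter> (T ^^ j) ` B = {}) \<and> (\<forall>i<N. (T ^^ i) ` B \<inter> E = {}) \<and>
      space ?R = (\<Union>i<N. (T ^^ i) ` B) \<union> E \<and> T ` E \<subseteq> B \<and>
      (\<forall>v\<in>Pow \<P>. measure ?R (B \<inter> {x \<in> space ?R. c x = v}) = measure ?R B * measure ?R {x \<in> space ?R. c x = v})"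
    proof (rule R.independent_strict_tower_exists[of N K "A \<inter> X" "Pow \<P>" c C])
      show "0 < N" using assms(6) by simp
      show "2 * (N * N) + (2 * N + 1) \<le> K" by (simp add: K_def L_def)
      show "A \<inter> X \<in> sets ?R" using R(2) A(1) X by auto
      show "(T ^^ i) x \<notin> A \<inter> X" if "x \<in> A \<inter> X" "0 < i" "i < K" for x i using A(3) that by auto
      show "\<exists>n. (S ^^ n) x \<in> A \<inter> X" "\<exists>n. (T ^^ n) x \<in> A \<inter> X" if "x \<in> space ?R" for x
        using good that TnX unfolding R(6) good_def by blast+
      show "divisible_measure ?R" by (rule R(5)[OF div])
      show "finite (Pow \<P>)" using assms(2) by simp
      show "c \<in> measurable ?R (count_space (Pow \<P>))" using c by (rule measurable_restrict_space1)
      show "real (2 * (2 * N + 1) + 2) * C * (real (2 * (N * N + (2 * N + 1))) / real K) < 1 / 2"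
        using small unfolding L_def .
      fix x and a :: "'a set set \<Rightarrow> real" assume "x \<in> space ?R"
      then have "good x" using good R(6) by simp
      moreover have "(\<lambda>y. a (c y)) \<in> borel_measurable M"
        by (rule measurable_compose[OF c]) simp
      moreover have "(\<lambda>y. a (c (T y))) \<in> borel_measurable M"
        by (rule measurable_compose[OF measurable_compose[OF T_meas c]]) simp
      ultimately show "\<bar>a (c x) - (\<integral>y. a (c y) \<partial>?R)\<bar> \<le> C * (\<integral>y. \<bar>a (c y) - a (c (T y))\<bar> \<partial>?R)"
        unfolding good_def by (simp add: R(4))
    qed
    then show ?thesis by (elim bexE conjE) (rule that)
  qed
  have BM: "B \<in> sets M" "E \<in> sets M" "B \<subseteq> X" "E \<subseteq> X" "\<And>i. (T ^^ i) ` B \<in> sets M"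
    using B levels R(2) by auto
  have "space M - X \<in> null_sets M"
    using full X prob_compl[OF X] prob_eq_1[OF X] by (simp add: null_sets_def emeasure_eq_measure)
  have "alpern_tower M T N B E"
    unfolding alpern_tower_def rohlin_tower_def partition_mod_null_def
  proof (intro conjI ballI impI)
    let ?F = "\<lambda>i. if i < N then (T ^^ i) ` B else E"
    fix i assume "i \<in> {..N}"
    show "?F i \<in> sets M" using BM by simp
    fix j assume "j \<in> {..N}" "i \<noteq> j"
    then have "?F i \<inter> ?F j = {}"
      using disj \<open>i \<in> {..N}\<close> by (cases "i < j") (auto simp: disjoint_iff not_less le_less)
    then show "?F i \<inter> ?F j \<in> null_sets M" by simp
  next
    have "(\<Union>i\<in>{..N}. if i < N then (T ^^ i) ` B else E) = X"
    proof -
      have "(\<Union>i\<in>{..N}. if i < N then (T ^^ i) ` B else E) = (\<Union>i<N. (T ^^ i) ` B) \<union> E"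
      proof -
        have "{..N} = insert N {..<N}" by auto
        then show ?thesis by auto
      qed
      then show ?thesis using cover R(6) by simp
    qed
    then show "space M - (\<Union>i\<in>{..N}. if i < N then (T ^^ i) ` B else E) \<in> null_sets M"
      using \<open>space M - X \<in> null_sets M\<close> by simp
    show "T ` E - B \<in> null_sets M" using TE by (simp add: Diff_eq_empty_iff[THEN iffD2])
  qed
  moreover have "prob (B \<inter> P) = prob B * prob P" if P: "P \<in> \<P>" for P
  proof -
    let ?V = "{v \<in> Pow \<P>. P \<in> v}"
    define cell where "cell v = {x \<in> X. c x = v}" for v
    have cell: "cell v \<in> sets M" if "v \<in> Pow \<P>" for v
    proof -
      have "cell v = {x \<in> space M. c x = v} \<inter> X" using sets.sets_into_space[OF X] by (auto simp: cell_def)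
      then show ?thesis using cellM[OF that] X by simp
    qed
    \<comment> \<open>On \<open>X\<close> the cell \<open>P\<close> is the disjoint union of the
      label classes \<open>v\<close> with \<open>P \<in> v\<close>, so independence from the labels
      adds up to independence from \<open>P\<close>.\<close>
    have sum: "prob (G \<inter> P) = (\<Sum>v\<in>?V. prob (G \<inter> cell v))" if G: "G \<in> sets M" for G
    proof -
      have "prob (G \<inter> P) = prob (\<Union>v\<in>?V. G \<inter> cell v)"
      proof (rule measure_eq_AE)
        show "AE x in M. x \<in> G \<inter> P \<longleftrightarrow> x \<in> (\<Union>v\<in>?V. G \<inter> cell v)"
          using full by eventually_elim (auto simp: cell_def c_def P)
        show "(\<Union>v\<in>?V. G \<inter> cell v) \<in> sets M"
          using G cell assms(2) by (intro sets.finite_UN) auto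
      qed (use G \<P>[OF P] in auto)
      also have "\<dots> = (\<Sum>v\<in>?V. prob (G \<inter> cell v))"
        using G cell assms(2) by (intro finite_measure_finite_Union) (auto simp: disjoint_family_on_def cell_def)
      finally show ?thesis .
    qed
    have "prob (B \<inter> cell v) = prob B * prob (cell v)" if "v \<in> ?V" for v
    proof -
      have "{x \<in> space ?R. c x = v} = cell v" by (simp add: cell_def R(6))
      moreover have "cell v \<subseteq> X" by (auto simp: cell_def)
      moreover have "B \<inter> cell v \<subseteq> X" by (auto simp: cell_def)
      moreover have "measure ?R (B \<inter> {x \<in> space ?R. c x = v}) = measure ?R B * measure ?R {x \<in> space ?R. c x = v}"
        using indep that by blast
      ultimately show ?thesis using R(3)[OF BM(3)] R(3)[of "cell v"] R(3)[of "B \<inter> cell v"] by (simp only:)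
    qed
    moreover have "prob P = (\<Sum>v\<in>?V. prob (cell v))"
    proof -
      have "space M \<inter> P = P" "space M \<inter> cell v = cell v" for v
        using sets.sets_into_space[OF \<P>[OF P]] sets.sets_into_space[OF X] by (auto simp: cell_def)
      then show ?thesis using sum[of "space M"] by simp
    qed
    ultimately show ?thesis using sum[OF BM(1)] by (simp add: sum_distrib_left)
  qed
  ultimately show ?thesis using BM by blast
qed

end
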